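(* Let $\mathfrak{g}_P$ and $\mathfrak{h}_Q$ be two averaging Lie algebras. Then there is a bijection $\mathrm{Ext}_{\mathrm{nab}}(\mathfrak{g}_P,\mathfrak{h}_Q)\cong H^2_{\mathrm{nab}}(\mathfrak{g}_P,\mathfrak{h}_Q)$ between the set of equivalence classes of non-abelian extensions of $\mathfrak{g}_P$ by $\mathfrak{h}_Q$ and the set of equivalence classes of non-abelian $2$-cocycles of $\mathfrak{g}_P$ with values in $\mathfrak{h}_Q$.
   Context: Everything is over a field of characteristic zero. An averaging operator on a Lie algebra $\mathfrak{g}$ is a linear map $P:\mathfrak{g}\to\mathfrak{g}$ with $[P(x),P(y)]_{\mathfrak{g}}=P([P(x),y]_{\mathfrak{g}})$ for all $x,y$; an averaging Lie algebra $\mathfrak{g}_P$ is a Lie algebra $\mathfrak{g}$ with an averaging operator $P$. A morphism $\mathfrak{g}_P\to\mathfrak{g}'_{P'}$ is a Lie algebra homomorphism $\tau$ with $P'\circ\tau=\tau\circ P$. A non-abelian extension of $\mathfrak{g}_P$ by $\mathfrak{h}_Q$ is an averaging Lie algebra $\mathfrak{e}_U$ with a short exact sequence $0\to\mathfrak{h}_Q\xrightarrow{i}\mathfrak{e}_U\xrightarrow{p}\mathfrak{g}_P\to0$ of averaging Lie algebras ($i,p$ morphisms). Two such extensions $\mathfrak{e}_U$ (with maps $i,p$) and $\mathfrak{e}'_{U'}$ (with maps $i',p'$) are equivalent if there is a morphism $\tau:\mathfrak{e}_U\to\mathfrak{e}'_{U'}$ of averaging Lie algebras with $\tau\circ i=i'$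 and $p'\circ\tau=p$. $\mathrm{Ext}_{\mathrm{nab}}(\mathfrak{g}_P,\mathfrak{h}_Q)$ is the set of equivalence classes. A non-abelian $2$-cocycle of $\mathfrak{g}_P$ with values in $\mathfrak{h}_Q$ is a triple $(\chi,\psi,\Phi)$ of linear maps $\chi:\wedge^2\mathfrak{g}\to\mathfrak{h}$, $\psi:\mathfrak{g}\to\mathrm{Der}(\mathfrak{h})$, $\Phi:\mathfrak{g}\to\mathfrak{h}$ such that for all $x,y,z\in\mathfrak{g}$, $h\in\mathfrak{h}$: (a) $\psi_x\psi_y(h)-\psi_y\psi_x(h)-\psi_{[x,y]_{\mathfrak{g}}}(h)=[\chi(x,y),h]_{\mathfrak{h}}$; (b) $\psi_x\chi(y,z)+\psi_y\chi(z,x)+\psi_z\chi(x,y)-\chi([x,y]_{\mathfrak{g}},z)-\chi([y,z]_{\mathfrak{g}},x)-\chi([z,x]_{\mathfrak{g}},y)=0$; (c) $\psi_{P(x)}Q(h)=Q(\psi_{P(x)}h)+Q[\Phi(x),h]_{\mathfrak{h}}-[\Phi(x),Q(h)]_{\mathfrak{h}}=Q(\psi_xQ(h))-[\Phi(x),Q(h)]_{\mathfrak{h}}$; (d) $\chi(P(x),P(y))-Q(\chi(P(x),y))-\Phi[P(x),y]_{\mathfrak{g}}+\psi_{P(x)}\Phi(y)-\psi_{P(y)}\Phi(x)+Q(\psi_y\Phi(x))+[\Phi(x),\Phi(y)]_{\mathfrak{h}}=0$. Two non-abelian $2$-cocycles $(\chi,\psi,\Phi)$ and $(\chi',\psi',\Phi')$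 are equivalent if there is a linear map $\phi:\mathfrak{g}\to\mathfrak{h}$ such that for all $x,y\in\mathfrak{g}$, $h\in\mathfrak{h}$: $\psi_xh-\psi'_xh=[\phi(x),h]_{\mathfrak{h}}$; $\chi(x,y)-\chi'(x,y)=\psi'_x\phi(y)-\psi'_y\phi(x)-\phi[x,y]_{\mathfrak{g}}+[\phi(x),\phi(y)]_{\mathfrak{h}}$; $\Phi(x)-\Phi'(x)=Q\phi(x)-\phi P(x)$. $H^2_{\mathrm{nab}}(\mathfrak{g}_P,\mathfrak{h}_Q)$ is the set of equivalence classes. *)

theory Defs
  imports "HOL-Algebra.Algebra"
begin

locale char_zero_field = field K for K (structure) +
  assumes char_zero: "(n::nat) > 0 \<Longrightarrow> [n] \<cdot> \<one> \<noteq> \<zero>"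

text \<open>
  The \<^const>\<open>monoid.mult\<close> and \<^const>\<open>monoid.one\<close> fields, which every \<open>module\<close> record inherits
  from \<open>ring\<close>, carry no meaning here; as for the library's modules nothing is assumed about them.
\<close>
record ('k, 'a) lie = "('k, 'a) module" +
  lie_bracket :: "'a \<Rightarrow> 'a \<Rightarrow> 'a"  (\<open>\<lbrakk>_,/ _\<rbrakk>\<index>\<close>)

definition linear_map ::
  "('k, 'r) ring_scheme \<Rightarrow> ('k, 'a, 'm) module_scheme \<Rightarrow> ('k, 'b, 'n) module_scheme \<Rightarrow> ('a \<Rightarrow> 'b) \<Rightarrow> bool"
where
  "linear_map K V W f \<longleftrightarrow>
     f \<in> carrier V \<rightarrow> carrier W \<and>
     (\<forall>x\<in>carrier V. \<forall>y\<in>carrier V. f (x \<oplus>\<^bsub>V\<^esub> y) = f x \<oplus>\<^bsub>W\<^esub> f y) \<and>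
     (\<forall>a\<in>carrier K. \<forall>x\<in>carrier V. f (a \<odot>\<^bsub>V\<^esub> x) = a \<odot>\<^bsub>W\<^esub> f x)"

text \<open>Linear maps \<open>\<wedge>\<^sup>2 V \<rightarrow> W\<close>, as alternating bilinear maps \<open>V \<times> V \<rightarrow> W\<close>.\<close>
definition alternating_bilinear_map ::
  "('k, 'r) ring_scheme \<Rightarrow> ('k, 'a, 'm) module_scheme \<Rightarrow> ('k, 'b, 'n) module_scheme \<Rightarrow> ('a \<Rightarrow> 'a \<Rightarrow> 'b) \<Rightarrow> bool"
where
  "alternating_bilinear_map K V W b \<longleftrightarrow>
     (\<forall>x\<in>carrier V. linear_map K V W (b x)) \<and>
     (\<forall>y\<in>carrier V. linear_map K V W (\<lambda>x. b x y)) \<and>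
     (\<forall>x\<in>carrier V. b x x = \<zero>\<^bsub>W\<^esub>)"

locale lie_algebra = field K + module K L
  for K :: "('k, 'r) ring_scheme" (structure) and L :: "('k, 'a) lie" (structure) +
  assumes bracket_alternating_bilinear: "alternating_bilinear_map K L L (lie_bracket L)"
    and jacobi: "\<lbrakk>x \<in> carrier L; y \<in> carrier L; z \<in> carrier L\<rbrakk> \<Longrightarrow>
      \<lbrakk>x, \<lbrakk>y, z\<rbrakk>\<^bsub>L\<^esub>\<rbrakk>\<^bsub>L\<^esub> \<oplus>\<^bsub>L\<^esub> \<lbrakk>y, \<lbrakk>z, x\<rbrakk>\<^bsub>L\<^esub>\<rbrakk>\<^bsub>L\<^esub> \<oplus>\<^bsub>L\<^esub> \<lbrakk>z, \<lbrakk>x, y\<rbrakk>\<^bsub>L\<^esub>\<rbrakk>\<^bsub>L\<^esub> = \<zero>\<^bsub>L\<^esub>"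

locale averaging_lie_algebra = lie_algebra K L
  for K :: "('k, 'r) ring_scheme" (structure) and L :: "('k, 'a) lie" (structure) +
  fixes P :: "'a \<Rightarrow> 'a"
  assumes operator_linear: "linear_map K L L P"
    and averaging: "\<lbrakk>x \<in> carrier L; y \<in> carrier L\<rbrakk> \<Longrightarrow> \<lbrakk>P x, P y\<rbrakk>\<^bsub>L\<^esub> = P \<lbrakk>P x, y\<rbrakk>\<^bsub>L\<^esub>"

definition averaging_hom ::
  "('k, 'r) ring_scheme \<Rightarrow> ('k, 'a) lie \<Rightarrow> ('a \<Rightarrow> 'a) \<Rightarrow> ('k, 'b) lie \<Rightarrow> ('b \<Rightarrow> 'b) \<Rightarrow> ('a \<Rightarrow> 'b) \<Rightarrow> bool"
where
  "averaging_hom K L P L' P' f \<longleftrightarrow>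
     linear_map K L L' f \<and>
     (\<forall>x\<in>carrier L. \<forall>y\<in>carrier L. f \<lbrakk>x, y\<rbrakk>\<^bsub>L\<^esub> = \<lbrakk>f x, f y\<rbrakk>\<^bsub>L'\<^esub>) \<and>
     (\<forall>x\<in>carrier L. P' (f x) = f (P x))"

definition derivation :: "('k, 'r) ring_scheme \<Rightarrow> ('k, 'a) lie \<Rightarrow> ('a \<Rightarrow> 'a) \<Rightarrow> bool" where
  "derivation K L d \<longleftrightarrow>
     linear_map K L L d \<and>
     (\<forall>x\<in>carrier L. \<forall>y\<in>carrier L. d \<lbrakk>x, y\<rbrakk>\<^bsub>L\<^esub> = \<lbrakk>d x, y\<rbrakk>\<^bsub>L\<^esub> \<oplus>\<^bsub>L\<^esub> \<lbrakk>x, d y\<rbrakk>\<^bsub>L\<^esub>)"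

text \<open>Linear maps \<open>V \<rightarrow> Der(L)\<close>; \<open>Der(L)\<close> has the pointwise operations.\<close>
definition linear_map_to_Der ::
  "('k, 'r) ring_scheme \<Rightarrow> ('k, 'a) lie \<Rightarrow> ('k, 'b) lie \<Rightarrow> ('a \<Rightarrow> 'b \<Rightarrow> 'b) \<Rightarrow> bool"
where
  "linear_map_to_Der K V L \<psi> \<longleftrightarrow>
     (\<forall>x\<in>carrier V. derivation K L (\<psi> x)) \<and>
     (\<forall>h\<in>carrier L. linear_map K V L (\<lambda>x. \<psi> x h))"


subsection \<open>Non-abelian extensions\<close>

record ('k, 'g, 'h, 'e) lie_extension =
  ext_alg :: "('k, 'e) lie"
  ext_op :: "'e \<Rightarrow> 'e"
  ext_incl :: "'h \<Rightarrow> 'e"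
  ext_proj :: "'e \<Rightarrow> 'g"

definition nonabelian_extension ::
  "('k, 'r) ring_scheme \<Rightarrow> ('k, 'g) lie \<Rightarrow> ('g \<Rightarrow> 'g) \<Rightarrow> ('k, 'h) lie \<Rightarrow> ('h \<Rightarrow> 'h) \<Rightarrow>
   ('k, 'g, 'h, 'e) lie_extension \<Rightarrow> bool"
where
  "nonabelian_extension K G P H Q E \<longleftrightarrow>
     averaging_lie_algebra K (ext_alg E) (ext_op E) \<and>
     averaging_hom K H Q (ext_alg E) (ext_op E) (ext_incl E) \<and>
     averaging_hom K (ext_alg E) (ext_op E) G P (ext_proj E) \<and>
     inj_on (ext_incl E) (carrier H) \<and>
     ext_incl E ` carrier H = {a \<in> carrier (ext_alg E). ext_proj E a = \<zero>\<^bsub>G\<^esub>} \<and>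
     ext_proj E ` carrier (ext_alg E) = carrier G"

definition extension_equivalent ::
  "('k, 'r) ring_scheme \<Rightarrow> ('k, 'g) lie \<Rightarrow> ('k, 'h) lie \<Rightarrow>
   ('k, 'g, 'h, 'e) lie_extension \<Rightarrow> ('k, 'g, 'h, 'e) lie_extension \<Rightarrow> bool"
where
  "extension_equivalent K G H E E' \<longleftrightarrow>
     (\<exists>\<tau>. averaging_hom K (ext_alg E) (ext_op E) (ext_alg E') (ext_op E') \<tau> \<and>
          (\<forall>h\<in>carrier H. \<tau> (ext_incl E h) = ext_incl E' h) \<and>
          (\<forall>a\<in>carrier (ext_alg E). ext_proj E' (\<tau> a) = ext_proj E a))"

text \<open>
  The extensions form a proper class in set theory; here the underlying sets of the extension
  algebras are the subsets of a type \<open>'e\<close>, which plays the role of the universe. Since an extension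
  of \<open>G\<close> by \<open>H\<close> has an underlying set in bijection with \<open>carrier G \<times> carrier H\<close>, all extensions are
  represented up to equivalence as soon as \<open>carrier G \<times> carrier H\<close> embeds into \<open>'e\<close>.

  The values of operations and maps outside the carriers are not constrained. They do not
  influence the equivalence classes, here and for cocycles below: two extensions, or two
  cocycles, that agree on the carriers are equivalent.
\<close>
definition Ext_nab ::
  "('k, 'r) ring_scheme \<Rightarrow> ('k, 'g) lie \<Rightarrow> ('g \<Rightarrow> 'g) \<Rightarrow> ('k, 'h) lie \<Rightarrow> ('h \<Rightarrow> 'h) \<Rightarrow>
   ('k, 'g, 'h, 'e) lie_extension set set"
where
  "Ext_nab K G P H Q =
     {E. nonabelian_extension K G P H Q E} //
     {(E, E'). nonabelian_extension K G P H Q E \<and> nonabelian_extension K G P H Q E' \<and>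
               extension_equivalent K G H E E'}"


subsection \<open>Non-abelian 2-cocycles\<close>

type_synonym ('g, 'h) cochain = "('g \<Rightarrow> 'g \<Rightarrow> 'h) \<times> ('g \<Rightarrow> 'h \<Rightarrow> 'h) \<times> ('g \<Rightarrow> 'h)"

definition nonabelian_cocycle ::
  "('k, 'r) ring_scheme \<Rightarrow> ('k, 'g) lie \<Rightarrow> ('g \<Rightarrow> 'g) \<Rightarrow> ('k, 'h) lie \<Rightarrow> ('h \<Rightarrow> 'h) \<Rightarrow>
   ('g, 'h) cochain \<Rightarrow> bool"
where
  "nonabelian_cocycle K G P H Q = (\<lambda>(\<chi>, \<psi>, \<Phi>).
     alternating_bilinear_map K G H \<chi> \<and> linear_map_to_Der K G H \<psi> \<and> linear_map K G H \<Phi> \<and>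
     (\<forall>x\<in>carrier G. \<forall>y\<in>carrier G. \<forall>h\<in>carrier H.
        \<psi> x (\<psi> y h) \<ominus>\<^bsub>H\<^esub> \<psi> y (\<psi> x h) \<ominus>\<^bsub>H\<^esub> \<psi> \<lbrakk>x, y\<rbrakk>\<^bsub>G\<^esub> h = \<lbrakk>\<chi> x y, h\<rbrakk>\<^bsub>H\<^esub>) \<and>
     (\<forall>x\<in>carrier G. \<forall>y\<in>carrier G. \<forall>z\<in>carrier G.
        \<psi> x (\<chi> y z) \<oplus>\<^bsub>H\<^esub> \<psi> y (\<chi> z x) \<oplus>\<^bsub>H\<^esub> \<psi> z (\<chi> x y)
          \<ominus>\<^bsub>H\<^esub> \<chi> \<lbrakk>x, y\<rbrakk>\<^bsub>G\<^esub> z \<ominus>\<^bsub>H\<^esub> \<chi> \<lbrakk>y, z\<rbrakk>\<^bsub>G\<^esub> x \<ominus>\<^bsub>H\<^esub> \<chi> \<lbrakk>z, x\<rbrakk>\<^bsub>G\<^esub> y = \<zero>\<^bsub>H\<^esub>) \<and>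
     (\<forall>x\<in>carrier G. \<forall>h\<in>carrier H.
        \<psi> (P x) (Q h) = Q (\<psi> (P x) h) \<oplus>\<^bsub>H\<^esub> Q \<lbrakk>\<Phi> x, h\<rbrakk>\<^bsub>H\<^esub> \<ominus>\<^bsub>H\<^esub> \<lbrakk>\<Phi> x, Q h\<rbrakk>\<^bsub>H\<^esub> \<and>
        \<psi> (P x) (Q h) = Q (\<psi> x (Q h)) \<ominus>\<^bsub>H\<^esub> \<lbrakk>\<Phi> x, Q h\<rbrakk>\<^bsub>H\<^esub>) \<and>
     (\<forall>x\<in>carrier G. \<forall>y\<in>carrier G.
        \<chi> (P x) (P y) \<ominus>\<^bsub>H\<^esub> Q (\<chi> (P x) y) \<ominus>\<^bsub>H\<^esub> \<Phi> \<lbrakk>P x, y\<rbrakk>\<^bsub>G\<^esub>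
          \<oplus>\<^bsub>H\<^esub> \<psi> (P x) (\<Phi> y) \<ominus>\<^bsub>H\<^esub> \<psi> (P y) (\<Phi> x) \<oplus>\<^bsub>H\<^esub> Q (\<psi> y (\<Phi> x))
          \<oplus>\<^bsub>H\<^esub> \<lbrakk>\<Phi> x, \<Phi> y\<rbrakk>\<^bsub>H\<^esub> = \<zero>\<^bsub>H\<^esub>))"

definition cocycle_equivalent ::
  "('k, 'r) ring_scheme \<Rightarrow> ('k, 'g) lie \<Rightarrow> ('g \<Rightarrow> 'g) \<Rightarrow> ('k, 'h) lie \<Rightarrow> ('h \<Rightarrow> 'h) \<Rightarrow>
   ('g, 'h) cochain \<Rightarrow> ('g, 'h) cochain \<Rightarrow> bool"
where
  "cocycle_equivalent K G P H Q = (\<lambda>(\<chi>, \<psi>, \<Phi>) (\<chi>', \<psi>', \<Phi>').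
     \<exists>\<phi>. linear_map K G H \<phi> \<and>
       (\<forall>x\<in>carrier G. \<forall>h\<in>carrier H. \<psi> x h \<ominus>\<^bsub>H\<^esub> \<psi>' x h = \<lbrakk>\<phi> x, h\<rbrakk>\<^bsub>H\<^esub>) \<and>
       (\<forall>x\<in>carrier G. \<forall>y\<in>carrier G.
          \<chi> x y \<ominus>\<^bsub>H\<^esub> \<chi>' x y
            = \<psi>' x (\<phi> y) \<ominus>\<^bsub>H\<^esub> \<psi>' y (\<phi> x) \<ominus>\<^bsub>H\<^esub> \<phi> \<lbrakk>x, y\<rbrakk>\<^bsub>G\<^esub> \<oplus>\<^bsub>H\<^esub> \<lbrakk>\<phi> x, \<phi> y\<rbrakk>\<^bsub>H\<^esub>) \<and>
       (\<forall>x\<in>carrier G. \<Phi> x \<ominus>\<^bsub>H\<^esub> \<Phi>' x = Q (\<phi> x) \<ominus>\<^bsub>H\<^esub> \<phi> (P x)))"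

definition H2_nab ::
  "('k, 'r) ring_scheme \<Rightarrow> ('k, 'g) lie \<Rightarrow> ('g \<Rightarrow> 'g) \<Rightarrow> ('k, 'h) lie \<Rightarrow> ('h \<Rightarrow> 'h) \<Rightarrow>
   ('g, 'h) cochain set set"
where
  "H2_nab K G P H Q =
     {c. nonabelian_cocycle K G P H Q c} //
     {(c, c'). nonabelian_cocycle K G P H Q c \<and> nonabelian_cocycle K G P H Q c' \<and>
               cocycle_equivalent K G P H Q c c'}"

end

theory Submission
  imports Defs
begin

text \<open>
  An extension of \<open>G\<close> by \<open>H\<close> with inclusion \<open>i\<close> and projection \<open>p\<close> splits as a sequence of vector spaces
  (\<open>linear_section_exists\<close>). A linear section \<open>s\<close> writes every element as \<open>s x + i h\<close>, and the bracket
  and the operator \<open>U\<close> are then determined by those of \<open>G\<close> and \<open>H\<close> and by the triple \<open>(\<chi>, \<psi>, \<Phi>)\<close> with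
  \<open>[s x, s y] = s [x, y] + i (\<chi> x y)\<close>, \<open>[s x, i h] = i (\<psi> x h)\<close> and \<open>U (s x) = s (P x) + i (\<Phi> x)\<close>.

  Conversely, any triple with \<open>\<chi>\<close> alternating bilinear, \<open>\<psi>\<close> bilinear and \<open>\<Phi>\<close> linear defines an
  alternating bracket and an operator on the direct sum. The Jacobi and averaging identities are additive in each argument, so they hold as
  soon as they hold on elements of the form \<open>s x\<close> and \<open>i h\<close>, and there they are, term by term, the
  cocycle identities. Hence the space is an averaging Lie algebra if and only if the triple is a
  cocycle (\<open>averaging_lie_algebra_iff_cocycle\<close>); this one equivalence shows both that extensions give
  cocycles and that cocycles give extensions.

  If two extensions carry sections \<open>s\<close> and \<open>s'\<close>, a linear map \<open>\<tau>\<close> compatible with inclusions and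
  projections satisfies \<open>\<tau> (s x) = s' x + i' (\<phi> x)\<close>, and evaluating the morphism conditions on the same
  generators gives exactly the conditions for \<open>\<phi>\<close> to be an equivalence of cocycles
  (\<open>equivalent_iff_cocycle_equivalent\<close>). Taking two sections of one extension, this also says that the
  class of the cocycle does not depend on the section.

  So the relation between extensions and cocycles given by \<open>some section of E induces c\<close> is total on
  both sides and matches the two notions of equivalence, and it therefore induces a bijection of the
  quotients (\<open>bij_betw_quotients_of_correspondence\<close>).
\<close>

section \<open>Quotients of corresponding sets\<close>

text \<open>
  A relation \<open>D\<close> that is total on both sides and turns \<open>R\<close> into \<open>S\<close> identifies the quotients.
  It replaces a pair of mutually inverse maps: an extension has many cocycles, one for each
  section, and no choice among them has to be made. Only \<open>R\<close> has to be known to be an equivalence;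
  \<open>S\<close> inherits reflexivity, symmetry and transitivity along \<open>D\<close>.
\<close>
lemma bij_betw_quotients_of_correspondence:
  assumes R: "equiv A R" and S: "S \<subseteq> B \<times> B"
    and left_total: "\<And>a. a \<in> A \<Longrightarrow> \<exists>b\<in>B. D a b"
    and right_total: "\<And>b. b \<in> B \<Longrightarrow> \<exists>a\<in>A. D a b"
    and compatible: "\<And>a a' b b'. \<lbrakk>a \<in> A; a' \<in> A; b \<in> B; b' \<in> B; D a b; D a' b'\<rbrakk> \<Longrightarrow>
      (a, a') \<in> R \<longleftrightarrow> (b, b') \<in> S"
  shows "\<exists>F. bij_betw F (A // R) (B // S)"
proof -
  have symR: "sym R" and transR: "trans R" and reflR: "refl_on A R" and RA: "R \<subseteq> A \<times> A"
    using R by (auto elim: equivE)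
  have eqS: "equiv B S"
  proof (rule equivI)
    show "S \<subseteq> B \<times> B" by (rule S)
    show "refl_on B S"
    proof (rule refl_onI)
      fix b assume b: "b \<in> B"
      then obtain a where a: "a \<in> A" "D a b" using right_total by blast
      then have "(a, a) \<in> R" using reflR by (blast dest: refl_onD)
      then show "(b, b) \<in> S" using compatible[of a a b b] a b by blast
    qed
    show "sym S"
    proof (rule symI)
      fix b b' assume bb: "(b, b') \<in> S"
      then obtain a a' where "a \<in> A" "a' \<in> A" "D a b" "D a' b'" "b \<in> B" "b' \<in> B"
        using right_total S by blast
      then show "(b', b) \<in> S"
        using compatible[of a a' b b'] compatible[of a' a b' b] bb symD[OF symR, of a a'] by blast
    qed
    show "trans S"
    proof (rule transI)
      fix b b' b'' assume bb: "(b, b') \<in> S" "(b', b'') \<in> S"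
      then have B: "b \<in> B" "b' \<in> B" "b'' \<in> B" using S by auto
      then obtain a a' a'' where "a \<in> A" "a' \<in> A" "a'' \<in> A" "D a b" "D a' b'" "D a'' b''"
        using right_total by metis
      with B show "(b, b'') \<in> S"
        using compatible[of a a' b b'] compatible[of a' a'' b' b''] compatible[of a a'' b b'']
          bb transD[OF transR, of a a' a''] by blast
    qed
  qed
  obtain f where f: "\<And>a. a \<in> A \<Longrightarrow> f a \<in> B \<and> D a (f a)"
    using left_total by metis
  have f_iff: "(f a, f a') \<in> S \<longleftrightarrow> (a, a') \<in> R" if "a \<in> A" "a' \<in> A" for a a'
    using that f compatible[of a a' "f a" "f a'"] by blast
  define F where "F Z = S `` (f ` Z)" for Z
  have F_class: "F (R `` {a}) = S `` {f a}" if a: "a \<in> A" for a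
  proof -
    have "(f a, b) \<in> S" if "(a, a') \<in> R" "(f a', b) \<in> S" for a' b
    proof -
      have "a' \<in> A" using that(1) RA by blast
      then have "(f a, f a') \<in> S" using f_iff a that(1) by blast
      then show ?thesis using that(2) eqS by (meson equivE transD)
    qed
    moreover have "(a, a) \<in> R" using a reflR by (blast dest: refl_onD)
    ultimately show ?thesis unfolding F_def by blast
  qed
  have "bij_betw F (A // R) (B // S)"
  proof (rule bij_betwI')
    fix Z Z' assume "Z \<in> A // R" "Z' \<in> A // R"
    then obtain a a' where a: "a \<in> A" "a' \<in> A" and Z: "Z = R `` {a}" and Z': "Z' = R `` {a'}"
      by (auto elim!: quotientE)
    show "F Z = F Z' \<longleftrightarrow> Z = Z'"
      using a f by (simp add: Z Z' F_class eq_equiv_class_iff[OF eqS] eq_equiv_class_iff[OF R] f_iff)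
  next
    fix Z assume "Z \<in> A // R"
    then show "F Z \<in> B // S"
      using f by (auto elim!: quotientE simp: F_class intro!: quotientI)
  next
    fix Z' assume "Z' \<in> B // S"
    then obtain b where b: "b \<in> B" "Z' = S `` {b}" by (auto elim: quotientE)
    then obtain a where a: "a \<in> A" "D a b" using right_total by blast
    have "(a, a) \<in> R" using a reflR by (blast dest: refl_onD)
    then have "(f a, b) \<in> S" using compatible a b f by blast
    then have "Z' = F (R `` {a})"
      using a b by (simp add: F_class equiv_class_eq[OF eqS])
    then show "\<exists>Z\<in>A // R. Z' = F Z" using a by (blast intro: quotientI)
  qed
  then show ?thesis by blast
qed

section \<open>Linear maps\<close>

context abelian_group
begin

lemma minus_eq_iff: "\<lbrakk>x \<in> carrier G; y \<in> carrier G; z \<in> carrier G\<rbrakk> \<Longrightarrow> x \<ominus> y = z \<longleftrightarrow> x = z \<oplus> y"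
  by (metis a_closed a_inv_closed a_assoc l_neg minus_eq r_neg r_zero)

lemma minus_eq_zero_iff: "\<lbrakk>x \<in> carrier G; y \<in> carrier G\<rbrakk> \<Longrightarrow> x \<ominus> y = \<zero> \<longleftrightarrow> x = y"
  by (simp add: minus_eq_iff)

end

lemma linear_mapI:
  assumes "\<And>x. x \<in> carrier V \<Longrightarrow> f x \<in> carrier W"
    and "\<And>x y. \<lbrakk>x \<in> carrier V; y \<in> carrier V\<rbrakk> \<Longrightarrow> f (x \<oplus>\<^bsub>V\<^esub> y) = f x \<oplus>\<^bsub>W\<^esub> f y"
    and "\<And>a x. \<lbrakk>a \<in> carrier K; x \<in> carrier V\<rbrakk> \<Longrightarrow> f (a \<odot>\<^bsub>V\<^esub> x) = a \<odot>\<^bsub>W\<^esub> f x"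
  shows "linear_map K V W f"
  using assms by (simp add: linear_map_def)

lemma linear_mapD:
  assumes "linear_map K V W f"
  shows "x \<in> carrier V \<Longrightarrow> f x \<in> carrier W"
    and "\<lbrakk>x \<in> carrier V; y \<in> carrier V\<rbrakk> \<Longrightarrow> f (x \<oplus>\<^bsub>V\<^esub> y) = f x \<oplus>\<^bsub>W\<^esub> f y"
    and "\<lbrakk>a \<in> carrier K; x \<in> carrier V\<rbrakk> \<Longrightarrow> f (a \<odot>\<^bsub>V\<^esub> x) = a \<odot>\<^bsub>W\<^esub> f x"
  using assms by (auto simp: linear_map_def)

locale linear_hom = V: module K V + W: module K W
  for K :: "('k, 'r) ring_scheme" and V :: "('k, 'a, 'm) module_scheme"
    and W :: "('k, 'b, 'n) module_scheme" +
  fixes f :: "'a \<Rightarrow> 'b"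
  assumes linear: "linear_map K V W f"
begin

lemma closed [simp]: "x \<in> carrier V \<Longrightarrow> f x \<in> carrier W"
  and add [simp]: "\<lbrakk>x \<in> carrier V; y \<in> carrier V\<rbrakk> \<Longrightarrow> f (x \<oplus>\<^bsub>V\<^esub> y) = f x \<oplus>\<^bsub>W\<^esub> f y"
  and smult [simp]: "\<lbrakk>a \<in> carrier K; x \<in> carrier V\<rbrakk> \<Longrightarrow> f (a \<odot>\<^bsub>V\<^esub> x) = a \<odot>\<^bsub>W\<^esub> f x"
  using linear_mapD[OF linear] by auto

lemma zero [simp]: "f \<zero>\<^bsub>V\<^esub> = \<zero>\<^bsub>W\<^esub>"
proof -
  have "f \<zero>\<^bsub>V\<^esub> = f (\<zero>\<^bsub>K\<^esub> \<odot>\<^bsub>V\<^esub> \<zero>\<^bsub>V\<^esub>)" by simp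
  also have "\<dots> = \<zero>\<^bsub>W\<^esub>" by (subst smult) simp_all
  finally show ?thesis .
qed

lemma neg [simp]: "x \<in> carrier V \<Longrightarrow> f (\<ominus>\<^bsub>V\<^esub> x) = \<ominus>\<^bsub>W\<^esub> f x"
  using add[of "\<ominus>\<^bsub>V\<^esub> x" x] by (simp add: V.l_neg W.M.minus_equality del: add)

lemma minus [simp]: "\<lbrakk>x \<in> carrier V; y \<in> carrier V\<rbrakk> \<Longrightarrow> f (x \<ominus>\<^bsub>V\<^esub> y) = f x \<ominus>\<^bsub>W\<^esub> f y"
  by (simp add: a_minus_def)

lemma inj_onI_kernel:
  assumes "\<And>x. \<lbrakk>x \<in> carrier V; f x = \<zero>\<^bsub>W\<^esub>\<rbrakk> \<Longrightarrow> x = \<zero>\<^bsub>V\<^esub>"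
  shows "inj_on f (carrier V)"
proof (rule inj_onI)
  fix x y assume xy: "x \<in> carrier V" "y \<in> carrier V" "f x = f y"
  then have "f (x \<ominus>\<^bsub>V\<^esub> y) = \<zero>\<^bsub>W\<^esub>" by (simp add: a_minus_def W.r_neg)
  then have "x \<ominus>\<^bsub>V\<^esub> y = \<zero>\<^bsub>V\<^esub>" using assms xy by blast
  then show "x = y" using xy by (simp add: V.M.minus_eq_zero_iff)
qed

end

lemma (in linear_hom) linear_inv:
  assumes inj: "inj_on f (carrier V)" and onto: "f ` carrier V = carrier W"
  shows "linear_map K W V (inv_into (carrier V) f)"
proof -
  let ?g = "inv_into (carrier V) f"
  have g: "?g w \<in> carrier V" "f (?g w) = w" if "w \<in> carrier W" for w
    using that onto inv_into_into[of w f "carrier V"] f_inv_into_f[of w f "carrier V"] by auto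
  show ?thesis
    by (rule linear_mapI) (auto simp: g intro!: inv_into_f_eq[OF inj])
qed

text \<open>
  The components of a cocycle are given through their images in the extension algebra. This
  lemma transfers linearity back along the inclusion of the ideal.
\<close>
lemma (in linear_hom) linear_factor_through_inj:
  assumes inj: "inj_on f (carrier V)" and U: "module K U"
    and closed': "\<And>x. x \<in> carrier U \<Longrightarrow> g x \<in> carrier V"
    and lin: "linear_map K U W (\<lambda>x. f (g x))"
  shows "linear_map K U V g"
proof (rule linear_mapI)
  interpret U: module K U by (rule U)
  show "g x \<in> carrier V" if "x \<in> carrier U" for x using that by (rule closed')
  show "g (x \<oplus>\<^bsub>U\<^esub> y) = g x \<oplus>\<^bsub>V\<^esub> g y" if "x \<in> carrier U" "y \<in> carrier U" for x y
    using that linear_mapD(2)[OF lin that]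
    by (intro inj_onD[OF inj]) (simp_all add: closed')
  show "g (a \<odot>\<^bsub>U\<^esub> x) = a \<odot>\<^bsub>V\<^esub> g x" if "a \<in> carrier K" "x \<in> carrier U" for a x
    using that linear_mapD(3)[OF lin that]
    by (intro inj_onD[OF inj]) (simp_all add: closed')
qed

text \<open>
  By Zorn's lemma there is a maximal submodule \<open>N\<close> of \<open>V\<close> that meets the kernel of \<open>f\<close> trivially. If
  \<open>f\<close> did not map \<open>N\<close> onto \<open>W\<close>, the line through a vector whose image is missed could be added to \<open>N\<close>;
  it is here that scalars have to be inverted. So \<open>f\<close> restricted to \<open>N\<close> is a linear isomorphism, and
  its inverse is a section.
\<close>
theorem linear_section_exists:
  assumes K: "field K" and lin: "linear_hom K V W f" and surj: "f ` carrier V = carrier W"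
  obtains s where "linear_map K W V s" "\<And>x. x \<in> carrier W \<Longrightarrow> f (s x) = x"
proof -
  interpret K: field K by (rule K)
  interpret linear_hom K V W f by (rule lin)
  define \<A> where "\<A> = {N. submodule N K V \<and> (\<forall>v\<in>N. f v = \<zero>\<^bsub>W\<^esub> \<longrightarrow> v = \<zero>\<^bsub>V\<^esub>)}"
  have "{\<zero>\<^bsub>V\<^esub>} \<in> \<A>"
    unfolding \<A>_def by (auto intro!: V.submoduleI)
  moreover have "\<Union>\<C> \<in> \<A>" if ne: "\<C> \<noteq> {}" and chain: "subset.chain \<A> \<C>" for \<C>
  proof -
    have sub: "\<And>N. N \<in> \<C> \<Longrightarrow> submodule N K V" and tr: "\<And>N v. N \<in> \<C> \<Longrightarrow> v \<in> N \<Longrightarrow> f v = \<zero>\<^bsub>W\<^esub> \<Longrightarrow> v = \<zero>\<^bsub>V\<^esub>"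
      using chain unfolding \<A>_def subset.chain_def by auto
    have "submodule (\<Union>\<C>) K V"
    proof (rule V.submoduleI)
      show "\<Union>\<C> \<subseteq> carrier V" using sub V.submoduleE(1) by blast
      obtain N v where "N \<in> \<C>" "v \<in> N" using ne sub V.submoduleE(2) by blast
      then show "\<zero>\<^bsub>V\<^esub> \<in> \<Union>\<C>" using sub V.submoduleE(1,4) 
        by (metis K.zero_closed UnionI V.smult_l_null subsetD)
      show "\<ominus>\<^bsub>V\<^esub> v \<in> \<Union>\<C>" if "v \<in> \<Union>\<C>" for v
        using that sub V.submoduleE(3) by blast
      show "a \<odot>\<^bsub>V\<^esub> v \<in> \<Union>\<C>" if "a \<in> carrier K" "v \<in> \<Union>\<C>" for a v
        using that sub V.submoduleE(4) by blast
      show "u \<oplus>\<^bsub>V\<^esub> v \<in> \<Union>\<C>" if uv: "u \<in> \<Union>\<C>" "v \<in> \<Union>\<C>" for u v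
      proof -
        obtain M N where MN: "M \<in> \<C>" "u \<in> M" "N \<in> \<C>" "v \<in> N" using uv by blast
        then have "M \<subseteq> N \<or> N \<subseteq> M" using chain unfolding subset.chain_def by blast
        then obtain L where "L \<in> \<C>" "u \<in> L" "v \<in> L" using MN by blast
        then show ?thesis using sub V.submoduleE(5) by blast
      qed
    qed
    then show ?thesis unfolding \<A>_def using tr by blast
  qed
  ultimately have "\<exists>N\<in>\<A>. \<forall>Y\<in>\<A>. N \<subseteq> Y \<longrightarrow> Y = N"
    by (intro subset_Zorn_nonempty) auto
  then obtain N where N: "N \<in> \<A>" and max: "\<And>Y. Y \<in> \<A> \<Longrightarrow> N \<subseteq> Y \<Longrightarrow> Y = N" by blast
  have sub: "submodule N K V" and tr: "\<And>v. v \<in> N \<Longrightarrow> f v = \<zero>\<^bsub>W\<^esub> \<Longrightarrow> v = \<zero>\<^bsub>V\<^esub>"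
    using N unfolding \<A>_def by auto
  have N_carrier: "v \<in> carrier V" if "v \<in> N" for v using that V.submoduleE(1)[OF sub] by blast
  have N_zero: "\<zero>\<^bsub>V\<^esub> \<in> N" using V.submoduleE(2,4)[OF sub] N_carrier
    by (metis K.zero_closed V.smult_l_null ex_in_conv)
  interpret N: linear_hom K "V\<lparr>carrier := N\<rparr>" W f
    using submodule.submodule_is_module[OF sub V.module_axioms] N_carrier
    by (auto intro!: linear_hom.intro linear_hom_axioms.intro W.module_axioms simp: linear_map_def)
  have inj: "inj_on f N" using N.inj_onI_kernel tr by simp
  have onto: "f ` N = carrier W"
  proof (rule ccontr)
    assume "f ` N \<noteq> carrier W"
    moreover have "f ` N \<subseteq> carrier W" using N_carrier by auto
    ultimately obtain w where w: "w \<in> carrier W" "w \<notin> f ` N" by blast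
    then obtain v where v: "v \<in> carrier V" "f v \<notin> f ` N" using surj by (metis imageE)
    define Y where "Y = {n \<oplus>\<^bsub>V\<^esub> a \<odot>\<^bsub>V\<^esub> v | n a. n \<in> N \<and> a \<in> carrier K}"
    have YI: "x \<in> Y" if "x = n \<oplus>\<^bsub>V\<^esub> a \<odot>\<^bsub>V\<^esub> v" "n \<in> N" "a \<in> carrier K" for x n a
      using that unfolding Y_def by blast
    have "submodule Y K V"
    proof (rule V.submoduleI)
      show "Y \<subseteq> carrier V" using v N_carrier unfolding Y_def by auto
      show "\<zero>\<^bsub>V\<^esub> \<in> Y" by (rule YI[of _ "\<zero>\<^bsub>V\<^esub>" "\<zero>\<^bsub>K\<^esub>"]) (use v N_zero in auto)
    next
      fix x assume "x \<in> Y"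
      then obtain n a where x: "x = n \<oplus>\<^bsub>V\<^esub> a \<odot>\<^bsub>V\<^esub> v" "n \<in> N" "a \<in> carrier K" unfolding Y_def by blast
      show "\<ominus>\<^bsub>V\<^esub> x \<in> Y"
        by (rule YI[of _ "\<ominus>\<^bsub>V\<^esub> n" "\<ominus>\<^bsub>K\<^esub> a"])
          (use x v N_carrier V.submoduleE(3)[OF sub] in \<open>auto simp: V.M.minus_add V.smult_l_minus\<close>)
      fix b assume b: "b \<in> carrier K"
      show "b \<odot>\<^bsub>V\<^esub> x \<in> Y"
        by (rule YI[of _ "b \<odot>\<^bsub>V\<^esub> n" "b \<otimes>\<^bsub>K\<^esub> a"])
          (use x v b N_carrier V.submoduleE(4)[OF sub] in \<open>auto simp: V.smult_r_distr V.smult_assoc1\<close>)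
    next
      fix x y assume "x \<in> Y" "y \<in> Y"
      then obtain n a m b where x: "x = n \<oplus>\<^bsub>V\<^esub> a \<odot>\<^bsub>V\<^esub> v" "n \<in> N" "a \<in> carrier K"
        and y: "y = m \<oplus>\<^bsub>V\<^esub> b \<odot>\<^bsub>V\<^esub> v" "m \<in> N" "b \<in> carrier K" unfolding Y_def by blast
      show "x \<oplus>\<^bsub>V\<^esub> y \<in> Y"
        by (rule YI[of _ "n \<oplus>\<^bsub>V\<^esub> m" "a \<oplus>\<^bsub>K\<^esub> b"])
          (use x y v N_carrier V.submoduleE(5)[OF sub] in \<open>auto simp: V.smult_l_distr V.M.a_ac\<close>)
    qed
    moreover have "x = \<zero>\<^bsub>V\<^esub>" if x: "x \<in> Y" "f x = \<zero>\<^bsub>W\<^esub>" for x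
    proof -
      obtain n a where x': "x = n \<oplus>\<^bsub>V\<^esub> a \<odot>\<^bsub>V\<^esub> v" "n \<in> N" "a \<in> carrier K" using x unfolding Y_def by blast
      have n: "n \<in> carrier V" using x' N_carrier by blast
      have fn: "f n = \<ominus>\<^bsub>W\<^esub> (a \<odot>\<^bsub>W\<^esub> f v)"
        using x x' v n by (metis add smult W.M.minus_equality closed V.smult_closed W.smult_closed)
      have "a = \<zero>\<^bsub>K\<^esub>"
      proof (rule ccontr)
        assume "a \<noteq> \<zero>\<^bsub>K\<^esub>"
        then have u: "a \<in> Units K" using x' K.field_Units by blast
        then have inv: "inv\<^bsub>K\<^esub> a \<in> carrier K" "inv\<^bsub>K\<^esub> a \<otimes>\<^bsub>K\<^esub> a = \<one>\<^bsub>K\<^esub>" by auto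
        \<comment> \<open>Solving \<open>f n + a f v = 0\<close> for \<open>f v\<close> puts it into \<open>f ` N\<close>.\<close>
        have "f ((\<ominus>\<^bsub>K\<^esub> (inv\<^bsub>K\<^esub> a)) \<odot>\<^bsub>V\<^esub> n) = f v"
          using inv x' v n
          by (simp add: fn K.l_minus W.smult_l_minus W.smult_r_minus W.smult_assoc1[symmetric])
        moreover have "(\<ominus>\<^bsub>K\<^esub> (inv\<^bsub>K\<^esub> a)) \<odot>\<^bsub>V\<^esub> n \<in> N"
          using inv x' V.submoduleE(4)[OF sub] by blast
        ultimately show False using v by (metis imageI)
      qed
      then show ?thesis using x x' v n tr by auto
    qed
    ultimately have "Y \<in> \<A>" unfolding \<A>_def by blast
    moreover have "N \<subseteq> Y"
    proof
      fix n assume "n \<in> N"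
      then show "n \<in> Y" by (intro YI[of _ n "\<zero>\<^bsub>K\<^esub>"]) (use v N_carrier in auto)
    qed
    ultimately have "Y = N" by (rule max)
    moreover have "v \<in> Y" by (rule YI[of _ "\<zero>\<^bsub>V\<^esub>" "\<one>\<^bsub>K\<^esub>"]) (use v N_zero in auto)
    ultimately show False using v by blast
  qed
  show thesis
  proof
    show "linear_map K W V (inv_into N f)"
      using N.linear_inv inj onto N_carrier by (simp add: linear_map_def Pi_iff)
    show "f (inv_into N f x) = x" if "x \<in> carrier W" for x
      using that onto by (metis f_inv_into_f)
  qed
qed

section \<open>Alternating maps\<close>

locale alternating_map = V: module K V + W: module K W
  for K :: "('k, 'r) ring_scheme" and V :: "('k, 'a, 'm) module_scheme"
    and W :: "('k, 'b, 'n) module_scheme" +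
  fixes b :: "'a \<Rightarrow> 'a \<Rightarrow> 'b"
  assumes alternating_bilinear: "alternating_bilinear_map K V W b"
begin

lemma linear_left: "y \<in> carrier V \<Longrightarrow> linear_hom K V W (\<lambda>x. b x y)"
  and linear_right: "x \<in> carrier V \<Longrightarrow> linear_hom K V W (b x)"
  and self [simp]: "x \<in> carrier V \<Longrightarrow> b x x = \<zero>\<^bsub>W\<^esub>"
  using alternating_bilinear V.module_axioms W.module_axioms
  by (auto simp: alternating_bilinear_map_def linear_hom_def linear_hom_axioms_def)

lemma closed [simp]: "\<lbrakk>x \<in> carrier V; y \<in> carrier V\<rbrakk> \<Longrightarrow> b x y \<in> carrier W"
  using linear_hom.closed[OF linear_right] .

lemma zero_left [simp]: "x \<in> carrier V \<Longrightarrow> b \<zero>\<^bsub>V\<^esub> x = \<zero>\<^bsub>W\<^esub>"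
  and zero_right [simp]: "x \<in> carrier V \<Longrightarrow> b x \<zero>\<^bsub>V\<^esub> = \<zero>\<^bsub>W\<^esub>"
  using linear_hom.zero[OF linear_left] linear_hom.zero[OF linear_right] by auto

lemma add_left [simp]: "\<lbrakk>x \<in> carrier V; x' \<in> carrier V; y \<in> carrier V\<rbrakk> \<Longrightarrow> b (x \<oplus>\<^bsub>V\<^esub> x') y = b x y \<oplus>\<^bsub>W\<^esub> b x' y"
  and add_right [simp]: "\<lbrakk>x \<in> carrier V; x' \<in> carrier V; y \<in> carrier V\<rbrakk> \<Longrightarrow> b y (x \<oplus>\<^bsub>V\<^esub> x') = b y x \<oplus>\<^bsub>W\<^esub> b y x'"
  using linear_hom.add[OF linear_left] linear_hom.add[OF linear_right] by auto

lemma neg_left [simp]: "\<lbrakk>x \<in> carrier V; y \<in> carrier V\<rbrakk> \<Longrightarrow> b (\<ominus>\<^bsub>V\<^esub> x) y = \<ominus>\<^bsub>W\<^esub> b x y"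
  and neg_right [simp]: "\<lbrakk>x \<in> carrier V; y \<in> carrier V\<rbrakk> \<Longrightarrow> b y (\<ominus>\<^bsub>V\<^esub> x) = \<ominus>\<^bsub>W\<^esub> b y x"
  using linear_hom.neg[OF linear_left] linear_hom.neg[OF linear_right] by auto

lemma smult_left [simp]: "\<lbrakk>a \<in> carrier K; x \<in> carrier V; y \<in> carrier V\<rbrakk> \<Longrightarrow> b (a \<odot>\<^bsub>V\<^esub> x) y = a \<odot>\<^bsub>W\<^esub> b x y"
  and smult_right [simp]: "\<lbrakk>a \<in> carrier K; x \<in> carrier V; y \<in> carrier V\<rbrakk> \<Longrightarrow> b y (a \<odot>\<^bsub>V\<^esub> x) = a \<odot>\<^bsub>W\<^esub> b y x"
  using linear_hom.smult[OF linear_left] linear_hom.smult[OF linear_right] by auto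

lemma antisym:
  assumes "x \<in> carrier V" "y \<in> carrier V"
  shows "b y x = \<ominus>\<^bsub>W\<^esub> b x y"
proof -
  have "b (x \<oplus>\<^bsub>V\<^esub> y) (x \<oplus>\<^bsub>V\<^esub> y) = b y x \<oplus>\<^bsub>W\<^esub> b x y"
    using assms by (simp add: W.M.a_comm del: self)
       (simp add: W.M.a_comm)
  then have "b y x \<oplus>\<^bsub>W\<^esub> b x y = \<zero>\<^bsub>W\<^esub>" using assms by (metis self V.a_closed)
  then show ?thesis using assms by (metis W.M.minus_equality closed)
qed

end

lemma alternating_mapI:
  assumes "module K V" "module K W"
    and "\<And>x y. \<lbrakk>x \<in> carrier V; y \<in> carrier V\<rbrakk> \<Longrightarrow> b x y \<in> carrier W"
    and "\<And>x x' y. \<lbrakk>x \<in> carrier V; x' \<in> carrier V; y \<in> carrier V\<rbrakk> \<Longrightarrow> b (x \<oplus>\<^bsub>V\<^esub> x') y = b x y \<oplus>\<^bsub>W\<^esub> b x' y"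
    and "\<And>x x' y. \<lbrakk>x \<in> carrier V; x' \<in> carrier V; y \<in> carrier V\<rbrakk> \<Longrightarrow> b y (x \<oplus>\<^bsub>V\<^esub> x') = b y x \<oplus>\<^bsub>W\<^esub> b y x'"
    and "\<And>a x y. \<lbrakk>a \<in> carrier K; x \<in> carrier V; y \<in> carrier V\<rbrakk> \<Longrightarrow> b (a \<odot>\<^bsub>V\<^esub> x) y = a \<odot>\<^bsub>W\<^esub> b x y"
    and "\<And>a x y. \<lbrakk>a \<in> carrier K; x \<in> carrier V; y \<in> carrier V\<rbrakk> \<Longrightarrow> b y (a \<odot>\<^bsub>V\<^esub> x) = a \<odot>\<^bsub>W\<^esub> b y x"
    and "\<And>x. x \<in> carrier V \<Longrightarrow> b x x = \<zero>\<^bsub>W\<^esub>"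
  shows "alternating_map K V W b"
  using assms
  by (intro alternating_map.intro alternating_map_axioms.intro)
    (auto simp: alternating_bilinear_map_def intro!: linear_mapI)

sublocale lie_algebra \<subseteq> bracket: alternating_map K L L "lie_bracket L"
  using bracket_alternating_bilinear by unfold_locales

sublocale averaging_lie_algebra \<subseteq> operator: linear_hom K L L P
  using operator_linear by unfold_locales

locale averaging_pair = G: averaging_lie_algebra K G P + H: averaging_lie_algebra K H Q
  for K :: "('k, 'r) ring_scheme" and G :: "('k, 'g) lie" and P :: "'g \<Rightarrow> 'g"
    and H :: "('k, 'h) lie" and Q :: "'h \<Rightarrow> 'h"

section \<open>Spaces with a chosen section\<close>

text \<open>
  \<open>E\<close> is a vector space with an alternating bracket and a linear operator \<open>U\<close>, but neither the Jacobi
  identity nor the averaging identity is assumed. The last three assumptions say that \<open>\<chi>\<close>, \<open>\<psi>\<close> and \<open>\<Phi>\<close>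
  measure how far the section \<open>s\<close> is from a morphism and how it acts on the ideal \<open>i H\<close>. They are
  written without inverses of \<open>i\<close>, so that they can be used as rewrite rules. In this setting both
  passages, from an extension to its cocycle and from a cocycle to an extension, are the two
  directions of one equivalence.
\<close>
locale sectioned_space = averaging_pair K G P H Q +
  E: alternating_map K E E "lie_bracket E" + U: linear_hom K E E U +
  i: linear_hom K H E i + p: linear_hom K E G p + s: linear_hom K G E s
  for K :: "('k, 'r) ring_scheme" and G :: "('k, 'g) lie" and P
    and H :: "('k, 'h) lie" and Q and E :: "('k, 'e) lie" and U i p s +
  fixes \<chi> :: "'g \<Rightarrow> 'g \<Rightarrow> 'h" and \<psi> :: "'g \<Rightarrow> 'h \<Rightarrow> 'h" and \<Phi> :: "'g \<Rightarrow> 'h"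
  assumes inj_i: "inj_on i (carrier H)"
    and kernel: "i ` carrier H = {a \<in> carrier E. p a = \<zero>\<^bsub>G\<^esub>}"
    and p_s [simp]: "x \<in> carrier G \<Longrightarrow> p (s x) = x"
    and i_bracket [simp]: "\<lbrakk>h \<in> carrier H; k \<in> carrier H\<rbrakk> \<Longrightarrow> \<lbrakk>i h, i k\<rbrakk>\<^bsub>E\<^esub> = i \<lbrakk>h, k\<rbrakk>\<^bsub>H\<^esub>"
    and i_operator [simp]: "h \<in> carrier H \<Longrightarrow> U (i h) = i (Q h)"
    and \<chi>_closed [simp]: "\<lbrakk>x \<in> carrier G; y \<in> carrier G\<rbrakk> \<Longrightarrow> \<chi> x y \<in> carrier H"
    and \<psi>_closed [simp]: "\<lbrakk>x \<in> carrier G; h \<in> carrier H\<rbrakk> \<Longrightarrow> \<psi> x h \<in> carrier H"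
    and \<Phi>_closed [simp]: "x \<in> carrier G \<Longrightarrow> \<Phi> x \<in> carrier H"
    and s_bracket [simp]: "\<lbrakk>x \<in> carrier G; y \<in> carrier G\<rbrakk> \<Longrightarrow> \<lbrakk>s x, s y\<rbrakk>\<^bsub>E\<^esub> = s \<lbrakk>x, y\<rbrakk>\<^bsub>G\<^esub> \<oplus>\<^bsub>E\<^esub> i (\<chi> x y)"
    and s_i_bracket [simp]: "\<lbrakk>x \<in> carrier G; h \<in> carrier H\<rbrakk> \<Longrightarrow> \<lbrakk>s x, i h\<rbrakk>\<^bsub>E\<^esub> = i (\<psi> x h)"
    and s_operator [simp]: "x \<in> carrier G \<Longrightarrow> U (s x) = s (P x) \<oplus>\<^bsub>E\<^esub> i (\<Phi> x)"
begin

lemma i_s_bracket [simp]: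
  "\<lbrakk>x \<in> carrier G; h \<in> carrier H\<rbrakk> \<Longrightarrow> \<lbrakk>i h, s x\<rbrakk>\<^bsub>E\<^esub> = \<ominus>\<^bsub>E\<^esub> i (\<psi> x h)"
  by (subst E.antisym[of "s x"]) simp_all

lemma i_eq_iff [simp]: "\<lbrakk>h \<in> carrier H; k \<in> carrier H\<rbrakk> \<Longrightarrow> i h = i k \<longleftrightarrow> h = k"
  using inj_i by (auto dest: inj_onD)

lemma i_eq_zero_iff [simp]: "h \<in> carrier H \<Longrightarrow> i h = \<zero>\<^bsub>E\<^esub> \<longleftrightarrow> h = \<zero>\<^bsub>H\<^esub>"
  using i_eq_iff[of h "\<zero>\<^bsub>H\<^esub>"] by (simp del: i_eq_iff)

lemma p_i [simp]: "h \<in> carrier H \<Longrightarrow> p (i h) = \<zero>\<^bsub>G\<^esub>"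
  using kernel by blast

lemma decomposition:
  assumes "a \<in> carrier E"
  obtains x h where "x \<in> carrier G" "h \<in> carrier H" "a = s x \<oplus>\<^bsub>E\<^esub> i h"
proof -
  have "a \<ominus>\<^bsub>E\<^esub> s (p a) \<in> i ` carrier H"
    using assms by (subst kernel) (simp add: G.M.minus_eq_zero_iff)
  then obtain h where h: "h \<in> carrier H" "a \<ominus>\<^bsub>E\<^esub> s (p a) = i h" by blast
  then have "a = s (p a) \<oplus>\<^bsub>E\<^esub> i h"
    using assms by (simp add: E.V.M.minus_eq_iff E.V.M.a_comm)
  with that[of "p a" h] h assms show thesis by simp
qed

lemma p_bracket: "\<lbrakk>a \<in> carrier E; b \<in> carrier E\<rbrakk> \<Longrightarrow> p \<lbrakk>a, b\<rbrakk>\<^bsub>E\<^esub> = \<lbrakk>p a, p b\<rbrakk>\<^bsub>G\<^esub>"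
  by (elim decomposition) simp

lemma p_operator: "a \<in> carrier E \<Longrightarrow> P (p a) = p (U a)"
  by (elim decomposition) simp

end

context sectioned_space begin

lemma \<Phi>_linear: "linear_map K G H \<Phi>"
proof (rule i.linear_factor_through_inj[OF inj_i G.module_axioms \<Phi>_closed])
  have "i (\<Phi> x) = U (s x) \<ominus>\<^bsub>E\<^esub> s (P x)" if "x \<in> carrier G" for x
    using that by (subst eq_commute) (simp add: E.V.M.minus_eq_iff E.V.M.a_comm)
  then show "linear_map K G E (\<lambda>x. i (\<Phi> x))"
    by (intro linear_mapI)
     (simp_all del: s_operator add: E.V.smult_r_distr E.V.smult_r_minus E.V.M.minus_add E.V.M.a_ac a_minus_def)
qed

lemma \<psi>_linear_left:
  assumes h: "h \<in> carrier H"
  shows "linear_map K G H (\<lambda>x. \<psi> x h)"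
proof (rule i.linear_factor_through_inj[OF inj_i G.module_axioms])
  show "linear_map K G E (\<lambda>x. i (\<psi> x h))"
    using h by (intro linear_mapI) (simp_all flip: s_i_bracket)
qed (use h in simp)

lemma \<psi>_linear_right:
  assumes x: "x \<in> carrier G"
  shows "linear_map K H H (\<psi> x)"
proof (rule i.linear_factor_through_inj[OF inj_i H.module_axioms])
  show "linear_map K H E (\<lambda>h. i (\<psi> x h))"
    using x by (intro linear_mapI) (simp_all flip: s_i_bracket)
qed (use x in simp)

lemma \<chi>_alternating: "alternating_bilinear_map K G H \<chi>"
  unfolding alternating_bilinear_map_def
proof (intro conjI ballI)
  have i_\<chi>: "i (\<chi> x y) = \<lbrakk>s x, s y\<rbrakk>\<^bsub>E\<^esub> \<ominus>\<^bsub>E\<^esub> s \<lbrakk>x, y\<rbrakk>\<^bsub>G\<^esub>" if "x \<in> carrier G" "y \<in> carrier G" for x y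
    using that by (subst eq_commute) (simp add: E.V.M.minus_eq_iff E.V.M.a_comm)
  fix x assume x: "x \<in> carrier G"
  show "linear_map K G H (\<chi> x)"
    by (rule i.linear_factor_through_inj[OF inj_i G.module_axioms], use x in simp, rule linear_mapI)
      (use x in \<open>simp_all add: i_\<chi> del: s_bracket\<close>,
       use x in \<open>simp_all del: s_bracket add: E.V.smult_r_distr E.V.smult_r_minus E.V.M.minus_add E.V.M.a_ac a_minus_def\<close>)
  show "linear_map K G H (\<lambda>y. \<chi> y x)"
    by (rule i.linear_factor_through_inj[OF inj_i G.module_axioms], use x in simp, rule linear_mapI)
      (use x in \<open>simp_all add: i_\<chi> del: s_bracket\<close>,
       use x in \<open>simp_all del: s_bracket add: E.V.smult_r_distr E.V.smult_r_minus E.V.M.minus_add E.V.M.a_ac a_minus_def\<close>)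
  have "i (\<chi> x x) = \<zero>\<^bsub>E\<^esub>" using x by (subst i_\<chi>) (simp_all del: s_bracket add: a_minus_def)
  then show "\<chi> x x = \<zero>\<^bsub>H\<^esub>" using x by simp
qed

sublocale \<Phi>: linear_hom K G H \<Phi>
  using \<Phi>_linear by unfold_locales

sublocale \<chi>: alternating_map K G H \<chi>
  using \<chi>_alternating by unfold_locales

lemma \<psi>_simps [simp]:
  "\<lbrakk>x \<in> carrier G; h \<in> carrier H; k \<in> carrier H\<rbrakk> \<Longrightarrow> \<psi> x (h \<oplus>\<^bsub>H\<^esub> k) = \<psi> x h \<oplus>\<^bsub>H\<^esub> \<psi> x k"
  "\<lbrakk>x \<in> carrier G; h \<in> carrier H\<rbrakk> \<Longrightarrow> \<psi> x (\<ominus>\<^bsub>H\<^esub> h) = \<ominus>\<^bsub>H\<^esub> \<psi> x h"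
  using linear_hom.add linear_hom.neg \<psi>_linear_right H.module_axioms
  by (metis linear_hom_axioms_def linear_hom_def)+

definition jacobiator where
  "jacobiator a b c = \<lbrakk>a, \<lbrakk>b, c\<rbrakk>\<^bsub>E\<^esub>\<rbrakk>\<^bsub>E\<^esub> \<oplus>\<^bsub>E\<^esub> \<lbrakk>b, \<lbrakk>c, a\<rbrakk>\<^bsub>E\<^esub>\<rbrakk>\<^bsub>E\<^esub> \<oplus>\<^bsub>E\<^esub> \<lbrakk>c, \<lbrakk>a, b\<rbrakk>\<^bsub>E\<^esub>\<rbrakk>\<^bsub>E\<^esub>"

lemma jacobiator_closed [simp]:
  "\<lbrakk>a \<in> carrier E; b \<in> carrier E; c \<in> carrier E\<rbrakk> \<Longrightarrow> jacobiator a b c \<in> carrier E"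
  by (simp add: jacobiator_def)

lemma jacobiator_cyclic:
  "\<lbrakk>a \<in> carrier E; b \<in> carrier E; c \<in> carrier E\<rbrakk> \<Longrightarrow> jacobiator b c a = jacobiator a b c"
  by (simp add: jacobiator_def E.V.M.a_ac)

lemma jacobiator_add:
  "\<lbrakk>a \<in> carrier E; a' \<in> carrier E; b \<in> carrier E; c \<in> carrier E\<rbrakk> \<Longrightarrow>
    jacobiator (a \<oplus>\<^bsub>E\<^esub> a') b c = jacobiator a b c \<oplus>\<^bsub>E\<^esub> jacobiator a' b c"
  by (simp add: jacobiator_def E.V.M.a_ac)

text \<open>
  The Jacobiator is additive in its first argument and invariant under cyclic permutations, hence
  additive in each, and \<open>E\<close> is spanned by \<open>s G\<close> and \<open>i H\<close>. Of the eight kinds of triples of generators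
  four remain up to cyclic permutation, and on \<open>i H\<close> the identity is the one of \<open>H\<close>.
\<close>
lemma jacobi_iff_generators:
  "(\<forall>a\<in>carrier E. \<forall>b\<in>carrier E. \<forall>c\<in>carrier E. jacobiator a b c = \<zero>\<^bsub>E\<^esub>) \<longleftrightarrow>
    (\<forall>x\<in>carrier G. \<forall>y\<in>carrier G. \<forall>z\<in>carrier G. jacobiator (s x) (s y) (s z) = \<zero>\<^bsub>E\<^esub>) \<and>
    (\<forall>x\<in>carrier G. \<forall>y\<in>carrier G. \<forall>h\<in>carrier H. jacobiator (s x) (s y) (i h) = \<zero>\<^bsub>E\<^esub>) \<and>
    (\<forall>x\<in>carrier G. \<forall>h\<in>carrier H. \<forall>k\<in>carrier H. jacobiator (s x) (i h) (i k) = \<zero>\<^bsub>E\<^esub>)"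
    (is "?all \<longleftrightarrow> ?sss \<and> ?ssi \<and> ?sii")
proof
  assume ?all then show "?sss \<and> ?ssi \<and> ?sii" by simp
next
  assume gen: "?sss \<and> ?ssi \<and> ?sii"
  have iii: "jacobiator (i h) (i k) (i l) = \<zero>\<^bsub>E\<^esub>" if "h \<in> carrier H" "k \<in> carrier H" "l \<in> carrier H" for h k l
  proof -
    have "jacobiator (i h) (i k) (i l) =
        i (\<lbrakk>h, \<lbrakk>k, l\<rbrakk>\<^bsub>H\<^esub>\<rbrakk>\<^bsub>H\<^esub> \<oplus>\<^bsub>H\<^esub> \<lbrakk>k, \<lbrakk>l, h\<rbrakk>\<^bsub>H\<^esub>\<rbrakk>\<^bsub>H\<^esub> \<oplus>\<^bsub>H\<^esub> \<lbrakk>l, \<lbrakk>h, k\<rbrakk>\<^bsub>H\<^esub>\<rbrakk>\<^bsub>H\<^esub>)"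
      using that by (simp add: jacobiator_def)
    then show ?thesis using that by (simp only: H.jacobi i.zero)
  qed
  define S where "S = s ` carrier G \<union> i ` carrier H"
  have S_carrier: "a \<in> carrier E" if "a \<in> S" for a using that unfolding S_def by auto
  have SSS: "jacobiator a b c = \<zero>\<^bsub>E\<^esub>" if "a \<in> S" "b \<in> S" "c \<in> S" for a b c
  proof -
    have ssi: "jacobiator (s x) (s y) (i h) = \<zero>\<^bsub>E\<^esub>" and sii: "jacobiator (s x) (i h) (i k) = \<zero>\<^bsub>E\<^esub>"
      if "x \<in> carrier G" "y \<in> carrier G" "h \<in> carrier H" "k \<in> carrier H" for x y h k
      using gen that by blast+
    have sis: "jacobiator (s x) (i h) (s y) = \<zero>\<^bsub>E\<^esub>" "jacobiator (i h) (s x) (s y) = \<zero>\<^bsub>E\<^esub>"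
      if "x \<in> carrier G" "y \<in> carrier G" "h \<in> carrier H" for x y h
      using that ssi[of y x h h] ssi[of x y h h]
        jacobiator_cyclic[of "s y" "s x" "i h"] jacobiator_cyclic[of "i h" "s x" "s y"] by simp_all
    have isi: "jacobiator (i h) (s x) (i k) = \<zero>\<^bsub>E\<^esub>" "jacobiator (i h) (i k) (s x) = \<zero>\<^bsub>E\<^esub>"
      if "x \<in> carrier G" "h \<in> carrier H" "k \<in> carrier H" for x h k
      using that sii[of x x k h] sii[of x x h k]
        jacobiator_cyclic[of "i h" "s x" "i k"] jacobiator_cyclic[of "s x" "i h" "i k"] by simp_all
    show ?thesis
      using that gen unfolding S_def by (elim UnE imageE) (simp_all add: ssi sii sis isi iii)
  qed
  have slot: "jacobiator a b c = \<zero>\<^bsub>E\<^esub>"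
    if "a \<in> carrier E" "b \<in> carrier E" "c \<in> carrier E" "\<And>d. d \<in> S \<Longrightarrow> jacobiator d b c = \<zero>\<^bsub>E\<^esub>" for a b c
    using that(1)
  proof (rule decomposition)
    fix x h assume "x \<in> carrier G" "h \<in> carrier H" "a = s x \<oplus>\<^bsub>E\<^esub> i h"
    then show ?thesis using that(2,3) that(4)[of "s x"] that(4)[of "i h"] by (simp add: jacobiator_add S_def)
  qed
  have ESS: "jacobiator a b c = \<zero>\<^bsub>E\<^esub>" if "a \<in> carrier E" "b \<in> S" "c \<in> S" for a b c
    by (rule slot[OF that(1) S_carrier[OF that(2)] S_carrier[OF that(3)] SSS[OF _ that(2,3)]])
  have EES: "jacobiator a b c = \<zero>\<^bsub>E\<^esub>" if "a \<in> carrier E" "b \<in> carrier E" "c \<in> S" for a b c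
  proof -
    have "jacobiator b c a = \<zero>\<^bsub>E\<^esub>"
    proof (rule slot)
      fix d assume "d \<in> S"
      then show "jacobiator d c a = \<zero>\<^bsub>E\<^esub>"
        using that ESS[of a d c] jacobiator_cyclic[of a d c] S_carrier by simp
    qed (simp_all add: that S_carrier)
    then show ?thesis using that jacobiator_cyclic[of a b c] S_carrier by simp
  qed
  have "jacobiator a b c = \<zero>\<^bsub>E\<^esub>" if "a \<in> carrier E" "b \<in> carrier E" "c \<in> carrier E" for a b c
  proof -
    have "jacobiator c a b = \<zero>\<^bsub>E\<^esub>"
    proof (rule slot)
      fix d assume "d \<in> S"
      then show "jacobiator d a b = \<zero>\<^bsub>E\<^esub>"
        using that EES[of a b d] jacobiator_cyclic[of d a b] S_carrier by simp
    qed (simp_all add: that)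
    then show ?thesis using that jacobiator_cyclic[of c a b] by simp
  qed
  then show ?all by blast
qed

lemma jacobiator_sss:
  assumes "x \<in> carrier G" "y \<in> carrier G" "z \<in> carrier G"
  shows "jacobiator (s x) (s y) (s z) =
    i (\<psi> x (\<chi> y z) \<oplus>\<^bsub>H\<^esub> \<psi> y (\<chi> z x) \<oplus>\<^bsub>H\<^esub> \<psi> z (\<chi> x y)
       \<ominus>\<^bsub>H\<^esub> \<chi> \<lbrakk>x, y\<rbrakk>\<^bsub>G\<^esub> z \<ominus>\<^bsub>H\<^esub> \<chi> \<lbrakk>y, z\<rbrakk>\<^bsub>G\<^esub> x \<ominus>\<^bsub>H\<^esub> \<chi> \<lbrakk>z, x\<rbrakk>\<^bsub>G\<^esub> y)" (is "_ = i ?B")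
proof -
  have anti: "\<chi> x \<lbrakk>y, z\<rbrakk>\<^bsub>G\<^esub> = \<ominus>\<^bsub>H\<^esub> \<chi> \<lbrakk>y, z\<rbrakk>\<^bsub>G\<^esub> x" "\<chi> y \<lbrakk>z, x\<rbrakk>\<^bsub>G\<^esub> = \<ominus>\<^bsub>H\<^esub> \<chi> \<lbrakk>z, x\<rbrakk>\<^bsub>G\<^esub> y"
    "\<chi> z \<lbrakk>x, y\<rbrakk>\<^bsub>G\<^esub> = \<ominus>\<^bsub>H\<^esub> \<chi> \<lbrakk>x, y\<rbrakk>\<^bsub>G\<^esub> z"
    by (rule \<chi>.antisym; use assms in simp)+
  have "jacobiator (s x) (s y) (s z) =
      s (\<lbrakk>x, \<lbrakk>y, z\<rbrakk>\<^bsub>G\<^esub>\<rbrakk>\<^bsub>G\<^esub> \<oplus>\<^bsub>G\<^esub> \<lbrakk>y, \<lbrakk>z, x\<rbrakk>\<^bsub>G\<^esub>\<rbrakk>\<^bsub>G\<^esub> \<oplus>\<^bsub>G\<^esub> \<lbrakk>z, \<lbrakk>x, y\<rbrakk>\<^bsub>G\<^esub>\<rbrakk>\<^bsub>G\<^esub>) \<oplus>\<^bsub>E\<^esub> i ?B"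
    using assms by (simp add: jacobiator_def anti a_minus_def E.V.M.a_ac)
  then show ?thesis using assms by (simp only: G.jacobi s.zero) simp
qed

lemma jacobiator_ssi:
  assumes "x \<in> carrier G" "y \<in> carrier G" "h \<in> carrier H"
  shows "jacobiator (s x) (s y) (i h) =
    i (\<psi> x (\<psi> y h) \<ominus>\<^bsub>H\<^esub> \<psi> y (\<psi> x h) \<ominus>\<^bsub>H\<^esub> \<psi> \<lbrakk>x, y\<rbrakk>\<^bsub>G\<^esub> h \<ominus>\<^bsub>H\<^esub> \<lbrakk>\<chi> x y, h\<rbrakk>\<^bsub>H\<^esub>)"
proof -
  have anti: "\<lbrakk>h, \<chi> x y\<rbrakk>\<^bsub>H\<^esub> = \<ominus>\<^bsub>H\<^esub> \<lbrakk>\<chi> x y, h\<rbrakk>\<^bsub>H\<^esub>"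
    by (rule H.bracket.antisym) (use assms in auto)
  show ?thesis
    using assms by (simp add: jacobiator_def anti a_minus_def E.V.M.a_ac E.V.M.minus_add)
qed

lemma jacobiator_sii:
  assumes "x \<in> carrier G" "h \<in> carrier H" "k \<in> carrier H"
  shows "jacobiator (s x) (i h) (i k) =
    i (\<psi> x \<lbrakk>h, k\<rbrakk>\<^bsub>H\<^esub> \<ominus>\<^bsub>H\<^esub> (\<lbrakk>\<psi> x h, k\<rbrakk>\<^bsub>H\<^esub> \<oplus>\<^bsub>H\<^esub> \<lbrakk>h, \<psi> x k\<rbrakk>\<^bsub>H\<^esub>))"
proof -
  have anti: "\<lbrakk>k, \<psi> x h\<rbrakk>\<^bsub>H\<^esub> = \<ominus>\<^bsub>H\<^esub> \<lbrakk>\<psi> x h, k\<rbrakk>\<^bsub>H\<^esub>"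
    by (rule H.bracket.antisym) (use assms in auto)
  show ?thesis
    using assms by (simp add: jacobiator_def anti a_minus_def E.V.M.a_ac E.V.M.minus_add)
qed

text \<open>
  The three kinds of triples of generators give one condition each: three elements of \<open>s G\<close> the
  cyclic identity for \<open>\<chi>\<close>, two of them the curvature identity for \<open>\<psi>\<close>, and one of them the
  derivation property of \<open>\<psi> x\<close>.
\<close>
lemma lie_algebra_iff:
  "lie_algebra K E \<longleftrightarrow>
     linear_map_to_Der K G H \<psi> \<and>
     (\<forall>x\<in>carrier G. \<forall>y\<in>carrier G. \<forall>h\<in>carrier H.
        \<psi> x (\<psi> y h) \<ominus>\<^bsub>H\<^esub> \<psi> y (\<psi> x h) \<ominus>\<^bsub>H\<^esub> \<psi> \<lbrakk>x, y\<rbrakk>\<^bsub>G\<^esub> h = \<lbrakk>\<chi> x y, h\<rbrakk>\<^bsub>H\<^esub>) \<and>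
     (\<forall>x\<in>carrier G. \<forall>y\<in>carrier G. \<forall>z\<in>carrier G.
        \<psi> x (\<chi> y z) \<oplus>\<^bsub>H\<^esub> \<psi> y (\<chi> z x) \<oplus>\<^bsub>H\<^esub> \<psi> z (\<chi> x y)
          \<ominus>\<^bsub>H\<^esub> \<chi> \<lbrakk>x, y\<rbrakk>\<^bsub>G\<^esub> z \<ominus>\<^bsub>H\<^esub> \<chi> \<lbrakk>y, z\<rbrakk>\<^bsub>G\<^esub> x \<ominus>\<^bsub>H\<^esub> \<chi> \<lbrakk>z, x\<rbrakk>\<^bsub>G\<^esub> y = \<zero>\<^bsub>H\<^esub>)"
    (is "_ \<longleftrightarrow> ?der \<and> ?a \<and> ?b")
proof -
  have "lie_algebra K E \<longleftrightarrow>
      (\<forall>a\<in>carrier E. \<forall>b\<in>carrier E. \<forall>c\<in>carrier E. jacobiator a b c = \<zero>\<^bsub>E\<^esub>)"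
    using G.field_axioms E.V.module_axioms E.alternating_bilinear
    by (auto simp: lie_algebra_def lie_algebra_axioms_def jacobiator_def)
  moreover have "(\<forall>x\<in>carrier G. \<forall>y\<in>carrier G. \<forall>z\<in>carrier G. jacobiator (s x) (s y) (s z) = \<zero>\<^bsub>E\<^esub>) \<longleftrightarrow> ?b"
    by (simp add: jacobiator_sss del: i.add i.minus)
  moreover have "(\<forall>x\<in>carrier G. \<forall>y\<in>carrier G. \<forall>h\<in>carrier H. jacobiator (s x) (s y) (i h) = \<zero>\<^bsub>E\<^esub>) \<longleftrightarrow> ?a"
    by (simp add: jacobiator_ssi H.M.minus_eq_zero_iff del: i.add i.minus)
  moreover have "(\<forall>x\<in>carrier G. \<forall>h\<in>carrier H. \<forall>k\<in>carrier H. jacobiator (s x) (i h) (i k) = \<zero>\<^bsub>E\<^esub>) \<longleftrightarrow> ?der"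
    by (simp add: jacobiator_sii H.M.minus_eq_zero_iff linear_map_to_Der_def derivation_def \<psi>_linear_left
        \<psi>_linear_right del: i.add i.minus)
  ultimately show ?thesis unfolding jacobi_iff_generators by blast
qed

text \<open>
  Both sides of the averaging identity are additive in \<open>a\<close> and \<open>b\<close>. They are not symmetric, so the
  mixed pairs give two conditions, which are the two equations for \<open>\<psi> (P x) (Q h)\<close> in a cocycle.
\<close>
lemma averaging_iff_generators:
  "(\<forall>a\<in>carrier E. \<forall>b\<in>carrier E. \<lbrakk>U a, U b\<rbrakk>\<^bsub>E\<^esub> = U \<lbrakk>U a, b\<rbrakk>\<^bsub>E\<^esub>) \<longleftrightarrow>
    (\<forall>x\<in>carrier G. \<forall>h\<in>carrier H. \<lbrakk>U (s x), U (i h)\<rbrakk>\<^bsub>E\<^esub> = U \<lbrakk>U (s x), i h\<rbrakk>\<^bsub>E\<^esub>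
       \<and> \<lbrakk>U (i h), U (s x)\<rbrakk>\<^bsub>E\<^esub> = U \<lbrakk>U (i h), s x\<rbrakk>\<^bsub>E\<^esub>) \<and>
    (\<forall>x\<in>carrier G. \<forall>y\<in>carrier G. \<lbrakk>U (s x), U (s y)\<rbrakk>\<^bsub>E\<^esub> = U \<lbrakk>U (s x), s y\<rbrakk>\<^bsub>E\<^esub>)"
    (is "?all \<longleftrightarrow> ?gen")
proof
  assume gen: ?gen
  show ?all
  proof (intro ballI)
    fix a b assume "a \<in> carrier E" "b \<in> carrier E"
    then obtain x h y k where x: "x \<in> carrier G" "h \<in> carrier H" "a = s x \<oplus>\<^bsub>E\<^esub> i h"
      and y: "y \<in> carrier G" "k \<in> carrier H" "b = s y \<oplus>\<^bsub>E\<^esub> i k"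
      by (metis decomposition)
    have ii: "\<lbrakk>U (i h), U (i k)\<rbrakk>\<^bsub>E\<^esub> = U \<lbrakk>U (i h), i k\<rbrakk>\<^bsub>E\<^esub>"
      using x y by (simp add: H.averaging)
    show "\<lbrakk>U a, U b\<rbrakk>\<^bsub>E\<^esub> = U \<lbrakk>U a, b\<rbrakk>\<^bsub>E\<^esub>"
      using x y gen ii by (simp del: s_operator i_operator)
  qed
qed (simp del: s_operator i_operator)

lemma averaging_si_iff:
  assumes "x \<in> carrier G" "h \<in> carrier H"
  shows "\<lbrakk>U (s x), U (i h)\<rbrakk>\<^bsub>E\<^esub> = U \<lbrakk>U (s x), i h\<rbrakk>\<^bsub>E\<^esub> \<longleftrightarrow>
    \<psi> (P x) (Q h) = Q (\<psi> (P x) h) \<oplus>\<^bsub>H\<^esub> Q \<lbrakk>\<Phi> x, h\<rbrakk>\<^bsub>H\<^esub> \<ominus>\<^bsub>H\<^esub> \<lbrakk>\<Phi> x, Q h\<rbrakk>\<^bsub>H\<^esub>"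
proof -
  have "\<lbrakk>U (s x), U (i h)\<rbrakk>\<^bsub>E\<^esub> = U \<lbrakk>U (s x), i h\<rbrakk>\<^bsub>E\<^esub> \<longleftrightarrow>
      i (\<psi> (P x) (Q h) \<oplus>\<^bsub>H\<^esub> \<lbrakk>\<Phi> x, Q h\<rbrakk>\<^bsub>H\<^esub>) = i (Q (\<psi> (P x) h) \<oplus>\<^bsub>H\<^esub> Q \<lbrakk>\<Phi> x, h\<rbrakk>\<^bsub>H\<^esub>)"
    using assms by (simp del: i_eq_iff)
  also have "\<dots> \<longleftrightarrow> Q (\<psi> (P x) h) \<oplus>\<^bsub>H\<^esub> Q \<lbrakk>\<Phi> x, h\<rbrakk>\<^bsub>H\<^esub> \<ominus>\<^bsub>H\<^esub> \<lbrakk>\<Phi> x, Q h\<rbrakk>\<^bsub>H\<^esub> = \<psi> (P x) (Q h)"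
    using assms by (subst i_eq_iff) (auto simp: H.M.minus_eq_iff)
  finally show ?thesis by (auto simp: eq_commute)
qed

lemma averaging_is_iff:
  assumes "x \<in> carrier G" "h \<in> carrier H"
  shows "\<lbrakk>U (i h), U (s x)\<rbrakk>\<^bsub>E\<^esub> = U \<lbrakk>U (i h), s x\<rbrakk>\<^bsub>E\<^esub> \<longleftrightarrow>
    \<psi> (P x) (Q h) = Q (\<psi> x (Q h)) \<ominus>\<^bsub>H\<^esub> \<lbrakk>\<Phi> x, Q h\<rbrakk>\<^bsub>H\<^esub>"
proof -
  have "\<lbrakk>Q h, \<Phi> x\<rbrakk>\<^bsub>H\<^esub> = \<ominus>\<^bsub>H\<^esub> \<lbrakk>\<Phi> x, Q h\<rbrakk>\<^bsub>H\<^esub>"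
    by (rule H.bracket.antisym) (use assms in auto)
  then have "\<lbrakk>U (i h), U (s x)\<rbrakk>\<^bsub>E\<^esub> = U \<lbrakk>U (i h), s x\<rbrakk>\<^bsub>E\<^esub> \<longleftrightarrow>
      i (\<ominus>\<^bsub>H\<^esub> (\<psi> (P x) (Q h) \<oplus>\<^bsub>H\<^esub> \<lbrakk>\<Phi> x, Q h\<rbrakk>\<^bsub>H\<^esub>)) = i (\<ominus>\<^bsub>H\<^esub> Q (\<psi> x (Q h)))"
    using assms by (simp del: i_eq_iff add: H.M.minus_add)
  also have "\<dots> \<longleftrightarrow> \<psi> (P x) (Q h) \<oplus>\<^bsub>H\<^esub> \<lbrakk>\<Phi> x, Q h\<rbrakk>\<^bsub>H\<^esub> = Q (\<psi> x (Q h))"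
    using assms by (subst i_eq_iff) (auto dest: inj_onD[OF H.M.a_inv_inj])
  also have "\<dots> \<longleftrightarrow> Q (\<psi> x (Q h)) \<ominus>\<^bsub>H\<^esub> \<lbrakk>\<Phi> x, Q h\<rbrakk>\<^bsub>H\<^esub> = \<psi> (P x) (Q h)"
    using assms by (auto simp: H.M.minus_eq_iff)
  finally show ?thesis by (auto simp: eq_commute)
qed

lemma averaging_ss_iff:
  assumes x: "x \<in> carrier G" "y \<in> carrier G"
  shows "\<lbrakk>U (s x), U (s y)\<rbrakk>\<^bsub>E\<^esub> = U \<lbrakk>U (s x), s y\<rbrakk>\<^bsub>E\<^esub> \<longleftrightarrow>
    \<chi> (P x) (P y) \<ominus>\<^bsub>H\<^esub> Q (\<chi> (P x) y) \<ominus>\<^bsub>H\<^esub> \<Phi> \<lbrakk>P x, y\<rbrakk>\<^bsub>G\<^esub>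
          \<oplus>\<^bsub>H\<^esub> \<psi> (P x) (\<Phi> y) \<ominus>\<^bsub>H\<^esub> \<psi> (P y) (\<Phi> x) \<oplus>\<^bsub>H\<^esub> Q (\<psi> y (\<Phi> x))
          \<oplus>\<^bsub>H\<^esub> \<lbrakk>\<Phi> x, \<Phi> y\<rbrakk>\<^bsub>H\<^esub> = \<zero>\<^bsub>H\<^esub>" (is "_ \<longleftrightarrow> ?d = _")
proof -
  let ?l = "\<chi> (P x) (P y) \<oplus>\<^bsub>H\<^esub> \<psi> (P x) (\<Phi> y) \<ominus>\<^bsub>H\<^esub> \<psi> (P y) (\<Phi> x) \<oplus>\<^bsub>H\<^esub> \<lbrakk>\<Phi> x, \<Phi> y\<rbrakk>\<^bsub>H\<^esub>"
  let ?r = "\<Phi> \<lbrakk>P x, y\<rbrakk>\<^bsub>G\<^esub> \<oplus>\<^bsub>H\<^esub> Q (\<chi> (P x) y) \<ominus>\<^bsub>H\<^esub> Q (\<psi> y (\<Phi> x))"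
  \<comment> \<open>The components in \<open>s G\<close> agree because \<open>P\<close> is averaging; those in \<open>i H\<close> are compared.\<close>
  have l: "\<lbrakk>U (s x), U (s y)\<rbrakk>\<^bsub>E\<^esub> = s \<lbrakk>P x, P y\<rbrakk>\<^bsub>G\<^esub> \<oplus>\<^bsub>E\<^esub> i ?l"
    using x by (simp add: a_minus_def E.V.M.a_ac del: i_eq_iff)
  have r: "U \<lbrakk>U (s x), s y\<rbrakk>\<^bsub>E\<^esub> = s \<lbrakk>P x, P y\<rbrakk>\<^bsub>G\<^esub> \<oplus>\<^bsub>E\<^esub> i ?r"
    using x by (simp add: a_minus_def E.V.M.a_ac G.averaging del: i_eq_iff)
  have "?d = ?l \<ominus>\<^bsub>H\<^esub> ?r"
    using x by (simp add: a_minus_def H.M.a_ac H.M.minus_add)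
  moreover have "s \<lbrakk>P x, P y\<rbrakk>\<^bsub>G\<^esub> \<oplus>\<^bsub>E\<^esub> i ?l = s \<lbrakk>P x, P y\<rbrakk>\<^bsub>G\<^esub> \<oplus>\<^bsub>E\<^esub> i ?r \<longleftrightarrow> i ?l = i ?r"
    using x by (simp del: i_eq_iff i.add i.minus)
  moreover have "i ?l = i ?r \<longleftrightarrow> ?l = ?r"
    by (rule i_eq_iff) (use x in simp_all)
  moreover have "?l \<ominus>\<^bsub>H\<^esub> ?r = \<zero>\<^bsub>H\<^esub> \<longleftrightarrow> ?l = ?r"
    by (rule H.M.minus_eq_zero_iff) (use x in simp_all)
  ultimately show ?thesis unfolding l r by metis
qed

theorem averaging_lie_algebra_iff_cocycle:
  "averaging_lie_algebra K E U \<longleftrightarrow> nonabelian_cocycle K G P H Q (\<chi>, \<psi>, \<Phi>)"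
proof -
  have "averaging_lie_algebra K E U \<longleftrightarrow> lie_algebra K E \<and>
      (\<forall>a\<in>carrier E. \<forall>b\<in>carrier E. \<lbrakk>U a, U b\<rbrakk>\<^bsub>E\<^esub> = U \<lbrakk>U a, b\<rbrakk>\<^bsub>E\<^esub>)"
    using U.linear by (auto simp: averaging_lie_algebra_def averaging_lie_algebra_axioms_def)
  then show ?thesis
    using \<Phi>_linear \<chi>_alternating
    by (simp add: nonabelian_cocycle_def lie_algebra_iff averaging_iff_generators
        averaging_si_iff averaging_is_iff averaging_ss_iff del: s_operator i_operator)
qed

end

section \<open>Morphisms between spaces with sections\<close>

text \<open>
  Two spaces over the same \<open>G\<close> and \<open>H\<close>, each with its section. A linear map \<open>\<tau>\<close> that respects inclusions
  and projections has \<open>\<tau> (s x) = s' x + i' (\<phi> x)\<close> for a linear map \<open>\<phi>\<close> from \<open>G\<close> to \<open>H\<close>, every \<open>\<phi>\<close>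
  occurs, and \<open>\<tau>\<close> is a morphism exactly when \<open>\<phi>\<close> exhibits the two cocycles as equivalent.
\<close>
locale sectioned_space_pair =
  E: sectioned_space K G P H Q E U i p s \<chi> \<psi> \<Phi> + E': sectioned_space K G P H Q E' U' i' p' s' \<chi>' \<psi>' \<Phi>'
  for K :: "('k, 'r) ring_scheme" and G :: "('k, 'g) lie" and P and H :: "('k, 'h) lie" and Q
    and E :: "('k, 'e) lie" and U i p s \<chi> \<psi> \<Phi>
    and E' :: "('k, 'f) lie" and U' i' p' s' \<chi>' \<psi>' \<Phi>'
begin

lemma hom_bracket_iff:
  assumes \<tau>: "linear_hom K E E' \<tau>"
    and i: "\<forall>h\<in>carrier H. \<tau> (i h) = i' h"
  shows "(\<forall>a\<in>carrier E. \<forall>b\<in>carrier E. \<tau> \<lbrakk>a, b\<rbrakk>\<^bsub>E\<^esub> = \<lbrakk>\<tau> a, \<tau> b\<rbrakk>\<^bsub>E'\<^esub>) \<longleftrightarrow>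
    (\<forall>x\<in>carrier G. \<forall>y\<in>carrier G. \<tau> \<lbrakk>s x, s y\<rbrakk>\<^bsub>E\<^esub> = \<lbrakk>\<tau> (s x), \<tau> (s y)\<rbrakk>\<^bsub>E'\<^esub>) \<and>
    (\<forall>x\<in>carrier G. \<forall>h\<in>carrier H. \<tau> \<lbrakk>s x, i h\<rbrakk>\<^bsub>E\<^esub> = \<lbrakk>\<tau> (s x), \<tau> (i h)\<rbrakk>\<^bsub>E'\<^esub>)"
    (is "?all \<longleftrightarrow> ?ss \<and> ?si")
proof
  assume ?all then show "?ss \<and> ?si" by (simp del: E.s_bracket E.s_i_bracket)
next
  interpret \<tau>: linear_hom K E E' \<tau> by (rule \<tau>)
  assume gen: "?ss \<and> ?si"
  show ?all
  proof (intro ballI)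
    fix a b assume "a \<in> carrier E" "b \<in> carrier E"
    then obtain x h y k where x: "x \<in> carrier G" "h \<in> carrier H" "a = s x \<oplus>\<^bsub>E\<^esub> i h"
      and y: "y \<in> carrier G" "k \<in> carrier H" "b = s y \<oplus>\<^bsub>E\<^esub> i k"
      by (metis E.decomposition)
    have si: "\<tau> \<lbrakk>s x, i k\<rbrakk>\<^bsub>E\<^esub> = \<lbrakk>\<tau> (s x), \<tau> (i k)\<rbrakk>\<^bsub>E'\<^esub>" "\<tau> \<lbrakk>s y, i h\<rbrakk>\<^bsub>E\<^esub> = \<lbrakk>\<tau> (s y), \<tau> (i h)\<rbrakk>\<^bsub>E'\<^esub>"
      and ss: "\<tau> \<lbrakk>s x, s y\<rbrakk>\<^bsub>E\<^esub> = \<lbrakk>\<tau> (s x), \<tau> (s y)\<rbrakk>\<^bsub>E'\<^esub>"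
      using gen x y by blast+
    have i_s: "\<tau> \<lbrakk>i h, s y\<rbrakk>\<^bsub>E\<^esub> = \<lbrakk>\<tau> (i h), \<tau> (s y)\<rbrakk>\<^bsub>E'\<^esub>"
    proof -
      have "\<tau> \<lbrakk>i h, s y\<rbrakk>\<^bsub>E\<^esub> = \<ominus>\<^bsub>E'\<^esub> \<tau> \<lbrakk>s y, i h\<rbrakk>\<^bsub>E\<^esub>"
        using x y by simp
      also have "\<dots> = \<lbrakk>\<tau> (i h), \<tau> (s y)\<rbrakk>\<^bsub>E'\<^esub>"
        unfolding si by (rule E'.E.antisym[symmetric]) (use x y in simp_all)
      finally show ?thesis .
    qed
    have ii: "\<tau> \<lbrakk>i h, i k\<rbrakk>\<^bsub>E\<^esub> = \<lbrakk>\<tau> (i h), \<tau> (i k)\<rbrakk>\<^bsub>E'\<^esub>"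
      using x y by (simp add: i)
    have "\<tau> \<lbrakk>a, b\<rbrakk>\<^bsub>E\<^esub> =
        \<tau> \<lbrakk>s x, s y\<rbrakk>\<^bsub>E\<^esub> \<oplus>\<^bsub>E'\<^esub> \<tau> \<lbrakk>i h, s y\<rbrakk>\<^bsub>E\<^esub> \<oplus>\<^bsub>E'\<^esub> (\<tau> \<lbrakk>s x, i k\<rbrakk>\<^bsub>E\<^esub> \<oplus>\<^bsub>E'\<^esub> \<tau> \<lbrakk>i h, i k\<rbrakk>\<^bsub>E\<^esub>)"
      using x y by (simp del: E.s_bracket E.s_i_bracket E.i_s_bracket E.i_bracket)
    also have "\<dots> = \<lbrakk>\<tau> a, \<tau> b\<rbrakk>\<^bsub>E'\<^esub>"
      unfolding ss si i_s ii using x y by simp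
    finally show "\<tau> \<lbrakk>a, b\<rbrakk>\<^bsub>E\<^esub> = \<lbrakk>\<tau> a, \<tau> b\<rbrakk>\<^bsub>E'\<^esub>" .
  qed
qed

lemma hom_operator_iff:
  assumes \<tau>: "linear_hom K E E' \<tau>"
    and i: "\<forall>h\<in>carrier H. \<tau> (i h) = i' h"
  shows "(\<forall>a\<in>carrier E. U' (\<tau> a) = \<tau> (U a)) \<longleftrightarrow> (\<forall>x\<in>carrier G. U' (\<tau> (s x)) = \<tau> (U (s x)))"
    (is "?all \<longleftrightarrow> ?gen")
proof
  interpret \<tau>: linear_hom K E E' \<tau> by (rule \<tau>)
  assume gen: ?gen
  show ?all
  proof
    fix a assume "a \<in> carrier E"
    then show "U' (\<tau> a) = \<tau> (U a)"
    proof (rule E.decomposition)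
      fix x h assume x: "x \<in> carrier G" "h \<in> carrier H" "a = s x \<oplus>\<^bsub>E\<^esub> i h"
      then have "U' (\<tau> (s x)) = \<tau> (U (s x))" using gen by blast
      moreover have "U' (\<tau> (i h)) = \<tau> (U (i h))" using x by (simp add: i)
      ultimately show ?thesis using x by (simp del: E.s_operator E.i_operator)
    qed
  qed
qed (simp del: E.s_operator)

context
  fixes \<tau> \<phi>
  assumes \<tau>: "linear_hom K E E' \<tau>"
    and \<phi>: "\<phi> \<in> carrier G \<rightarrow> carrier H"
    and on_i: "\<forall>h\<in>carrier H. \<tau> (i h) = i' h"
    and on_s: "\<forall>x\<in>carrier G. \<tau> (s x) = s' x \<oplus>\<^bsub>E'\<^esub> i' (\<phi> x)"
begin

private lemma
  \<phi>_closed: "x \<in> carrier G \<Longrightarrow> \<phi> x \<in> carrier H" and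
  \<tau>_i: "h \<in> carrier H \<Longrightarrow> \<tau> (i h) = i' h" and
  \<tau>_s: "x \<in> carrier G \<Longrightarrow> \<tau> (s x) = s' x \<oplus>\<^bsub>E'\<^esub> i' (\<phi> x)"
  using \<phi> on_i on_s by auto

interpretation \<tau>: linear_hom K E E' \<tau> by (rule \<tau>)

lemma comparison_linear: "linear_map K G H \<phi>"
proof (rule E'.i.linear_factor_through_inj[OF E'.inj_i E.G.module_axioms \<phi>_closed])
  have "i' (\<phi> x) = \<tau> (s x) \<ominus>\<^bsub>E'\<^esub> s' x" if "x \<in> carrier G" for x
    using that \<phi>_closed by (subst eq_commute) (simp add: \<tau>_s E'.E.V.M.minus_eq_iff E'.E.V.M.a_comm)
  then show "linear_map K G E' (\<lambda>x. i' (\<phi> x))"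
    by (intro linear_mapI)
     (simp_all add: E'.E.V.smult_r_distr E'.E.V.smult_r_minus E'.E.V.M.minus_add E'.E.V.M.a_ac a_minus_def)
qed

lemma hom_ss_iff:
  assumes x: "x \<in> carrier G" "y \<in> carrier G"
  shows "\<tau> \<lbrakk>s x, s y\<rbrakk>\<^bsub>E\<^esub> = \<lbrakk>\<tau> (s x), \<tau> (s y)\<rbrakk>\<^bsub>E'\<^esub> \<longleftrightarrow>
    \<chi> x y \<ominus>\<^bsub>H\<^esub> \<chi>' x y
      = \<psi>' x (\<phi> y) \<ominus>\<^bsub>H\<^esub> \<psi>' y (\<phi> x) \<ominus>\<^bsub>H\<^esub> \<phi> \<lbrakk>x, y\<rbrakk>\<^bsub>G\<^esub> \<oplus>\<^bsub>H\<^esub> \<lbrakk>\<phi> x, \<phi> y\<rbrakk>\<^bsub>H\<^esub>" (is "_ \<longleftrightarrow> _ = ?d")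
proof -
  let ?r = "\<chi>' x y \<oplus>\<^bsub>H\<^esub> \<psi>' x (\<phi> y) \<ominus>\<^bsub>H\<^esub> \<psi>' y (\<phi> x) \<oplus>\<^bsub>H\<^esub> \<lbrakk>\<phi> x, \<phi> y\<rbrakk>\<^bsub>H\<^esub>"
  note c [simp] = x \<phi>_closed[OF x(1)] \<phi>_closed[OF x(2)] \<phi>_closed[of "\<lbrakk>x, y\<rbrakk>\<^bsub>G\<^esub>"]
  have l: "\<tau> \<lbrakk>s x, s y\<rbrakk>\<^bsub>E\<^esub> = s' \<lbrakk>x, y\<rbrakk>\<^bsub>G\<^esub> \<oplus>\<^bsub>E'\<^esub> i' (\<chi> x y \<oplus>\<^bsub>H\<^esub> \<phi> \<lbrakk>x, y\<rbrakk>\<^bsub>G\<^esub>)"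
    by (simp add: \<tau>_s \<tau>_i E'.E.V.M.a_ac)
  have r: "\<lbrakk>\<tau> (s x), \<tau> (s y)\<rbrakk>\<^bsub>E'\<^esub> = s' \<lbrakk>x, y\<rbrakk>\<^bsub>G\<^esub> \<oplus>\<^bsub>E'\<^esub> i' ?r"
    by (simp add: \<tau>_s a_minus_def E'.E.V.M.a_ac)
  have "?d \<oplus>\<^bsub>H\<^esub> \<chi>' x y = ?r \<ominus>\<^bsub>H\<^esub> \<phi> \<lbrakk>x, y\<rbrakk>\<^bsub>G\<^esub>"
    by (simp add: a_minus_def E.H.M.a_ac)
  moreover have "\<chi> x y \<ominus>\<^bsub>H\<^esub> \<chi>' x y = ?d \<longleftrightarrow> \<chi> x y = ?d \<oplus>\<^bsub>H\<^esub> \<chi>' x y"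
    by (rule E.H.M.minus_eq_iff) simp_all
  moreover have "?r \<ominus>\<^bsub>H\<^esub> \<phi> \<lbrakk>x, y\<rbrakk>\<^bsub>G\<^esub> = \<chi> x y \<longleftrightarrow> ?r = \<chi> x y \<oplus>\<^bsub>H\<^esub> \<phi> \<lbrakk>x, y\<rbrakk>\<^bsub>G\<^esub>"
    by (rule E.H.M.minus_eq_iff) simp_all
  moreover have "s' \<lbrakk>x, y\<rbrakk>\<^bsub>G\<^esub> \<oplus>\<^bsub>E'\<^esub> i' (\<chi> x y \<oplus>\<^bsub>H\<^esub> \<phi> \<lbrakk>x, y\<rbrakk>\<^bsub>G\<^esub>) = s' \<lbrakk>x, y\<rbrakk>\<^bsub>G\<^esub> \<oplus>\<^bsub>E'\<^esub> i' ?r \<longleftrightarrow>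
      i' (\<chi> x y \<oplus>\<^bsub>H\<^esub> \<phi> \<lbrakk>x, y\<rbrakk>\<^bsub>G\<^esub>) = i' ?r"
    by (simp del: E'.i_eq_iff E'.i.add E'.i.minus)
  moreover have "i' (\<chi> x y \<oplus>\<^bsub>H\<^esub> \<phi> \<lbrakk>x, y\<rbrakk>\<^bsub>G\<^esub>) = i' ?r \<longleftrightarrow> \<chi> x y \<oplus>\<^bsub>H\<^esub> \<phi> \<lbrakk>x, y\<rbrakk>\<^bsub>G\<^esub> = ?r"
    by (rule E'.i_eq_iff) simp_all
  ultimately show ?thesis unfolding l r by metis
qed

lemma hom_si_iff:
  assumes x: "x \<in> carrier G" "h \<in> carrier H"
  shows "\<tau> \<lbrakk>s x, i h\<rbrakk>\<^bsub>E\<^esub> = \<lbrakk>\<tau> (s x), \<tau> (i h)\<rbrakk>\<^bsub>E'\<^esub> \<longleftrightarrow> \<psi> x h \<ominus>\<^bsub>H\<^esub> \<psi>' x h = \<lbrakk>\<phi> x, h\<rbrakk>\<^bsub>H\<^esub>"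
proof -
  note c [simp] = x \<phi>_closed[OF x(1)]
  have "\<tau> \<lbrakk>s x, i h\<rbrakk>\<^bsub>E\<^esub> = \<lbrakk>\<tau> (s x), \<tau> (i h)\<rbrakk>\<^bsub>E'\<^esub> \<longleftrightarrow> i' (\<psi> x h) = i' (\<lbrakk>\<phi> x, h\<rbrakk>\<^bsub>H\<^esub> \<oplus>\<^bsub>H\<^esub> \<psi>' x h)"
    by (simp add: \<tau>_s \<tau>_i E'.E.V.M.a_comm del: E'.i_eq_iff)
  also have "\<dots> \<longleftrightarrow> \<psi> x h \<ominus>\<^bsub>H\<^esub> \<psi>' x h = \<lbrakk>\<phi> x, h\<rbrakk>\<^bsub>H\<^esub>"
    by (simp add: E.H.M.minus_eq_iff del: E'.i.add)
  finally show ?thesis .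
qed

lemma hom_operator_s_iff:
  assumes x: "x \<in> carrier G"
  shows "U' (\<tau> (s x)) = \<tau> (U (s x)) \<longleftrightarrow> \<Phi> x \<ominus>\<^bsub>H\<^esub> \<Phi>' x = Q (\<phi> x) \<ominus>\<^bsub>H\<^esub> \<phi> (P x)"
proof -
  note c [simp] = x \<phi>_closed[OF x(1)] \<phi>_closed[of "P x"]
  have l: "U' (\<tau> (s x)) = s' (P x) \<oplus>\<^bsub>E'\<^esub> i' (Q (\<phi> x) \<oplus>\<^bsub>H\<^esub> \<Phi>' x)"
    by (simp add: \<tau>_s E'.E.V.M.a_ac)
  have r: "\<tau> (U (s x)) = s' (P x) \<oplus>\<^bsub>E'\<^esub> i' (\<Phi> x \<oplus>\<^bsub>H\<^esub> \<phi> (P x))"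
    by (simp add: \<tau>_s \<tau>_i E'.E.V.M.a_ac)
  have "U' (\<tau> (s x)) = \<tau> (U (s x)) \<longleftrightarrow> Q (\<phi> x) \<oplus>\<^bsub>H\<^esub> \<Phi>' x = \<Phi> x \<oplus>\<^bsub>H\<^esub> \<phi> (P x)"
    unfolding l r by (simp del: E'.i.add)
  moreover have "Q (\<phi> x) \<oplus>\<^bsub>H\<^esub> \<Phi>' x \<ominus>\<^bsub>H\<^esub> \<phi> (P x) = \<Phi> x \<longleftrightarrow> Q (\<phi> x) \<oplus>\<^bsub>H\<^esub> \<Phi>' x = \<Phi> x \<oplus>\<^bsub>H\<^esub> \<phi> (P x)"
    by (rule E.H.M.minus_eq_iff) simp_all
  moreover have "\<Phi> x \<ominus>\<^bsub>H\<^esub> \<Phi>' x = Q (\<phi> x) \<ominus>\<^bsub>H\<^esub> \<phi> (P x) \<longleftrightarrow> \<Phi> x = Q (\<phi> x) \<ominus>\<^bsub>H\<^esub> \<phi> (P x) \<oplus>\<^bsub>H\<^esub> \<Phi>' x"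
    by (rule E.H.M.minus_eq_iff) simp_all
  moreover have "Q (\<phi> x) \<oplus>\<^bsub>H\<^esub> \<Phi>' x \<ominus>\<^bsub>H\<^esub> \<phi> (P x) = Q (\<phi> x) \<ominus>\<^bsub>H\<^esub> \<phi> (P x) \<oplus>\<^bsub>H\<^esub> \<Phi>' x"
    by (simp add: a_minus_def E.H.M.a_ac)
  ultimately show ?thesis by metis
qed

lemma averaging_hom_iff_comparison:
  "averaging_hom K E U E' U' \<tau> \<longleftrightarrow>
     (\<forall>x\<in>carrier G. \<forall>h\<in>carrier H. \<psi> x h \<ominus>\<^bsub>H\<^esub> \<psi>' x h = \<lbrakk>\<phi> x, h\<rbrakk>\<^bsub>H\<^esub>) \<and>
     (\<forall>x\<in>carrier G. \<forall>y\<in>carrier G.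
        \<chi> x y \<ominus>\<^bsub>H\<^esub> \<chi>' x y
          = \<psi>' x (\<phi> y) \<ominus>\<^bsub>H\<^esub> \<psi>' y (\<phi> x) \<ominus>\<^bsub>H\<^esub> \<phi> \<lbrakk>x, y\<rbrakk>\<^bsub>G\<^esub> \<oplus>\<^bsub>H\<^esub> \<lbrakk>\<phi> x, \<phi> y\<rbrakk>\<^bsub>H\<^esub>) \<and>
     (\<forall>x\<in>carrier G. \<Phi> x \<ominus>\<^bsub>H\<^esub> \<Phi>' x = Q (\<phi> x) \<ominus>\<^bsub>H\<^esub> \<phi> (P x))"
  unfolding averaging_hom_def hom_bracket_iff[OF \<tau> on_i] hom_operator_iff[OF \<tau> on_i]
  by (simp only: \<tau>.linear hom_ss_iff hom_si_iff hom_operator_s_iff simp_thms cong: ball_cong) blast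

end

text \<open>
  In the decomposition of \<open>E\<close> as \<open>s G\<close> plus \<open>i H\<close> the component of \<open>a\<close> in \<open>H\<close> is the preimage \<open>r a\<close> of
  \<open>a - s (p a)\<close> under \<open>i\<close>, which makes the required map explicit and visibly linear.
\<close>
lemma comparison_map_exists:
  assumes lin: "linear_map K G H \<phi>"
  obtains \<tau> where "linear_hom K E E' \<tau>"
    "\<forall>h\<in>carrier H. \<tau> (i h) = i' h" "\<forall>x\<in>carrier G. \<tau> (s x) = s' x \<oplus>\<^bsub>E'\<^esub> i' (\<phi> x)"
proof -
  interpret \<phi>: linear_hom K G H \<phi>
    using lin by unfold_locales
  define r where "r a = inv_into (carrier H) i (a \<ominus>\<^bsub>E\<^esub> s (p a))" for a
  have r: "r a \<in> carrier H" "i (r a) = a \<ominus>\<^bsub>E\<^esub> s (p a)" if "a \<in> carrier E" for a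
  proof -
    have "a \<ominus>\<^bsub>E\<^esub> s (p a) \<in> i ` carrier H"
      using that by (subst E.kernel) (simp add: E.G.M.minus_eq_zero_iff)
    then show "r a \<in> carrier H" "i (r a) = a \<ominus>\<^bsub>E\<^esub> s (p a)"
      unfolding r_def by (auto intro: inv_into_into f_inv_into_f)
  qed
  interpret r: linear_hom K E H r
  proof unfold_locales
    show "linear_map K E H r"
    proof (rule E.i.linear_factor_through_inj[OF E.inj_i E.E.V.module_axioms r(1)])
      show "linear_map K E E (\<lambda>a. i (r a))"
        by (rule linear_mapI)
          (simp_all add: r E.E.V.smult_r_distr E.E.V.smult_r_minus E.E.V.M.minus_add E.E.V.M.a_ac a_minus_def)
    qed
  qed
  define \<tau> where "\<tau> a = s' (p a) \<oplus>\<^bsub>E'\<^esub> i' (\<phi> (p a) \<oplus>\<^bsub>H\<^esub> r a)" for a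
  have "linear_map K E E' \<tau>"
    by (rule linear_mapI) (simp_all add: \<tau>_def E'.E.V.smult_r_distr E'.E.V.M.a_ac)
  then have "linear_hom K E E' \<tau>" by unfold_locales
  moreover have "\<tau> (s x) = s' x \<oplus>\<^bsub>E'\<^esub> i' (\<phi> x)" if "x \<in> carrier G" for x
  proof -
    have "i (r (s x)) = \<zero>\<^bsub>E\<^esub>" using that by (simp add: r E.E.V.M.minus_eq_zero_iff)
    then have "r (s x) = \<zero>\<^bsub>H\<^esub>" using that by simp
    then show ?thesis using that by (simp add: \<tau>_def)
  qed
  moreover have "\<tau> (i h) = i' h" if "h \<in> carrier H" for h
  proof -
    have "i (r (i h)) = i h" using that by (simp add: r a_minus_def del: E.i_eq_iff)
    then have "r (i h) = h" using that by simp
    then show ?thesis using that by (simp add: \<tau>_def)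
  qed
  ultimately show thesis using that by blast
qed

theorem equivalent_iff_cocycle_equivalent:
  "(\<exists>\<tau>. averaging_hom K E U E' U' \<tau> \<and> (\<forall>h\<in>carrier H. \<tau> (i h) = i' h) \<and>
        (\<forall>a\<in>carrier E. p' (\<tau> a) = p a))
    \<longleftrightarrow> cocycle_equivalent K G P H Q (\<chi>, \<psi>, \<Phi>) (\<chi>', \<psi>', \<Phi>')"
proof
  assume "\<exists>\<tau>. averaging_hom K E U E' U' \<tau> \<and> (\<forall>h\<in>carrier H. \<tau> (i h) = i' h) \<and>
      (\<forall>a\<in>carrier E. p' (\<tau> a) = p a)"
  then obtain \<tau> where hom: "averaging_hom K E U E' U' \<tau>"
    and \<tau>_i: "\<forall>h\<in>carrier H. \<tau> (i h) = i' h" and p: "\<And>a. a \<in> carrier E \<Longrightarrow> p' (\<tau> a) = p a"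
    by blast
  interpret \<tau>: linear_hom K E E' \<tau>
    using hom by unfold_locales (simp add: averaging_hom_def)
  have "\<exists>k\<in>carrier H. \<tau> (s x) = s' x \<oplus>\<^bsub>E'\<^esub> i' k" if x: "x \<in> carrier G" for x
  proof -
    have "\<tau> (s x) \<ominus>\<^bsub>E'\<^esub> s' x \<in> i' ` carrier H"
      using x by (subst E'.kernel) (simp add: p E.G.M.minus_eq_zero_iff)
    then obtain k where "k \<in> carrier H" "\<tau> (s x) \<ominus>\<^bsub>E'\<^esub> s' x = i' k" by blast
    then show ?thesis
      using x by (auto simp: E'.E.V.M.minus_eq_iff E'.E.V.M.a_comm intro!: bexI[of _ k])
  qed
  then obtain \<phi> where \<phi>: "\<phi> \<in> carrier G \<rightarrow> carrier H" "\<forall>x\<in>carrier G. \<tau> (s x) = s' x \<oplus>\<^bsub>E'\<^esub> i' (\<phi> x)"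
    by (metis Pi_I')
  note * = \<tau>.linear_hom_axioms \<phi>(1) \<tau>_i \<phi>(2)
  show "cocycle_equivalent K G P H Q (\<chi>, \<psi>, \<Phi>) (\<chi>', \<psi>', \<Phi>')"
    unfolding cocycle_equivalent_def prod.case
    using comparison_linear[OF *] averaging_hom_iff_comparison[OF *] hom by blast
next
  assume "cocycle_equivalent K G P H Q (\<chi>, \<psi>, \<Phi>) (\<chi>', \<psi>', \<Phi>')"
  then obtain \<phi> where lin: "linear_map K G H \<phi>"
    and eqs: "(\<forall>x\<in>carrier G. \<forall>h\<in>carrier H. \<psi> x h \<ominus>\<^bsub>H\<^esub> \<psi>' x h = \<lbrakk>\<phi> x, h\<rbrakk>\<^bsub>H\<^esub>) \<and>
     (\<forall>x\<in>carrier G. \<forall>y\<in>carrier G.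
        \<chi> x y \<ominus>\<^bsub>H\<^esub> \<chi>' x y
          = \<psi>' x (\<phi> y) \<ominus>\<^bsub>H\<^esub> \<psi>' y (\<phi> x) \<ominus>\<^bsub>H\<^esub> \<phi> \<lbrakk>x, y\<rbrakk>\<^bsub>G\<^esub> \<oplus>\<^bsub>H\<^esub> \<lbrakk>\<phi> x, \<phi> y\<rbrakk>\<^bsub>H\<^esub>) \<and>
     (\<forall>x\<in>carrier G. \<Phi> x \<ominus>\<^bsub>H\<^esub> \<Phi>' x = Q (\<phi> x) \<ominus>\<^bsub>H\<^esub> \<phi> (P x))"
    unfolding cocycle_equivalent_def prod.case by blast
  have \<phi>: "\<phi> \<in> carrier G \<rightarrow> carrier H" using lin by (simp add: linear_map_def)
  obtain \<tau> where \<tau>: "linear_hom K E E' \<tau>"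
    "\<forall>h\<in>carrier H. \<tau> (i h) = i' h" "\<forall>x\<in>carrier G. \<tau> (s x) = s' x \<oplus>\<^bsub>E'\<^esub> i' (\<phi> x)"
    by (rule comparison_map_exists[OF lin])
  interpret \<tau>: linear_hom K E E' \<tau> by (rule \<tau>(1))
  have "averaging_hom K E U E' U' \<tau>"
    using averaging_hom_iff_comparison[OF \<tau>(1) \<phi> \<tau>(2,3)] eqs by blast
  moreover have "p' (\<tau> a) = p a" if "a \<in> carrier E" for a
    using that by (rule E.decomposition) (use \<phi> in \<open>simp add: \<tau> Pi_iff\<close>)
  ultimately show "\<exists>\<tau>. averaging_hom K E U E' U' \<tau> \<and> (\<forall>h\<in>carrier H. \<tau> (i h) = i' h) \<and>
      (\<forall>a\<in>carrier E. p' (\<tau> a) = p a)"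
    using \<tau>(2) by blast
qed

end

section \<open>Extensions and their cocycles\<close>

lemma (in sectioned_space) nonabelian_extension_iff_cocycle:
  "nonabelian_extension K G P H Q \<lparr>ext_alg = E, ext_op = U, ext_incl = i, ext_proj = p\<rparr> \<longleftrightarrow>
    nonabelian_cocycle K G P H Q (\<chi>, \<psi>, \<Phi>)"
proof -
  have "x \<in> p ` carrier E" if "x \<in> carrier G" for x
    using that by (intro image_eqI[of _ _ "s x"]) simp_all
  then have "p ` carrier E = carrier G" by auto
  then show ?thesis
    using i.linear p.linear inj_i kernel
    by (simp add: nonabelian_extension_def averaging_hom_def p_bracket p_operator
        averaging_lie_algebra_iff_cocycle)
qed

text \<open>
  The correspondence between extensions and cocycles: some linear section of \<open>E\<close> induces the given
  triple. The identities that make \<open>E\<close> an extension and the triple a cocycle are not part of it; each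
  of the two properties implies the other.
\<close>
definition cocycle_of_extension ::
  "('k, 'r) ring_scheme \<Rightarrow> ('k, 'g) lie \<Rightarrow> ('g \<Rightarrow> 'g) \<Rightarrow> ('k, 'h) lie \<Rightarrow> ('h \<Rightarrow> 'h) \<Rightarrow>
   ('k, 'g, 'h, 'e) lie_extension \<Rightarrow> ('g, 'h) cochain \<Rightarrow> bool"
where
  "cocycle_of_extension K G P H Q E = (\<lambda>(\<chi>, \<psi>, \<Phi>).
     \<exists>s. sectioned_space K G P H Q (ext_alg E) (ext_op E) (ext_incl E) (ext_proj E) s \<chi> \<psi> \<Phi>)"

context averaging_pair begin

lemma extension_iff_cocycle:
  assumes "cocycle_of_extension K G P H Q E c"
  shows "nonabelian_extension K G P H Q E \<longleftrightarrow> nonabelian_cocycle K G P H Q c"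
  using assms sectioned_space.nonabelian_extension_iff_cocycle
  by (cases c; cases E) (fastforce simp: cocycle_of_extension_def)

lemma extension_equivalent_iff_cocycle_equivalent:
  assumes "cocycle_of_extension K G P H Q E c" "cocycle_of_extension K G P H Q E' c'"
  shows "extension_equivalent K G H E E' \<longleftrightarrow> cocycle_equivalent K G P H Q c c'"
proof -
  obtain \<chi> \<psi> \<Phi> \<chi>' \<psi>' \<Phi>' where c: "c = (\<chi>, \<psi>, \<Phi>)" "c' = (\<chi>', \<psi>', \<Phi>')"
    by (cases c; cases c')
  then obtain s s' where
    s: "sectioned_space K G P H Q (ext_alg E) (ext_op E) (ext_incl E) (ext_proj E) s \<chi> \<psi> \<Phi>" and
    s': "sectioned_space K G P H Q (ext_alg E') (ext_op E') (ext_incl E') (ext_proj E') s' \<chi>' \<psi>' \<Phi>'"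
    using assms by (auto simp: cocycle_of_extension_def)
  interpret sectioned_space_pair K G P H Q
    "ext_alg E" "ext_op E" "ext_incl E" "ext_proj E" s \<chi> \<psi> \<Phi>
    "ext_alg E'" "ext_op E'" "ext_incl E'" "ext_proj E'" s' \<chi>' \<psi>' \<Phi>'
    by (rule sectioned_space_pair.intro[OF s s'])
  show ?thesis
    unfolding extension_equivalent_def c by (rule equivalent_iff_cocycle_equivalent)
qed

text \<open>
  For a linear section \<open>s\<close> the elements \<open>[s x, s y] - s [x, y]\<close>, \<open>[s x, i h]\<close> and \<open>U (s x) - s (P x)\<close> lie in
  the kernel of the projection, because it is a morphism; their preimages in \<open>H\<close> form the triple.
\<close>
lemma extension_has_cocycle:
  assumes ext: "nonabelian_extension K G P H Q E"
  shows "\<exists>c. cocycle_of_extension K G P H Q E c"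
proof -
  define L U i p where "L = ext_alg E" and "U = ext_op E" and "i = ext_incl E" and "p = ext_proj E"
  have avg: "averaging_lie_algebra K L U" and i_hom: "averaging_hom K H Q L U i"
    and p_hom: "averaging_hom K L U G P p" and inj: "inj_on i (carrier H)"
    and kernel: "i ` carrier H = {a \<in> carrier L. p a = \<zero>\<^bsub>G\<^esub>}" and surj: "p ` carrier L = carrier G"
    using ext unfolding nonabelian_extension_def L_def U_def i_def p_def by blast+
  interpret L: averaging_lie_algebra K L U by (rule avg)
  interpret i: linear_hom K H L i using i_hom by unfold_locales (simp add: averaging_hom_def)
  interpret p: linear_hom K L G p using p_hom by unfold_locales (simp add: averaging_hom_def)
  have p_bracket: "p \<lbrakk>a, b\<rbrakk>\<^bsub>L\<^esub> = \<lbrakk>p a, p b\<rbrakk>\<^bsub>G\<^esub>" if "a \<in> carrier L" "b \<in> carrier L" for a b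
    using p_hom that by (simp add: averaging_hom_def)
  have p_U: "p (U a) = P (p a)" if "a \<in> carrier L" for a
    using p_hom that by (simp add: averaging_hom_def)
  have p_i: "p (i h) = \<zero>\<^bsub>G\<^esub>" if "h \<in> carrier H" for h using kernel that by blast
  obtain s where s_lin: "linear_map K G L s" and p_s: "\<And>x. x \<in> carrier G \<Longrightarrow> p (s x) = x"
    using linear_section_exists[OF G.field_axioms p.linear_hom_axioms surj] by blast
  interpret s: linear_hom K G L s using s_lin by unfold_locales
  define j where "j = inv_into (carrier H) i"
  have j: "j a \<in> carrier H" "i (j a) = a" if "a \<in> carrier L" "p a = \<zero>\<^bsub>G\<^esub>" for a
  proof -
    have "a \<in> i ` carrier H" using kernel that by blast
    then show "j a \<in> carrier H" "i (j a) = a" unfolding j_def by (auto intro: inv_into_into f_inv_into_f)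
  qed
  have add_minus: "a = b \<oplus>\<^bsub>L\<^esub> (a \<ominus>\<^bsub>L\<^esub> b)" if "a \<in> carrier L" "b \<in> carrier L" for a b
    using that L.minus_eq_iff[of a b "a \<ominus>\<^bsub>L\<^esub> b"] by (simp add: L.a_comm)
  define \<chi> where "\<chi> x y = j (\<lbrakk>s x, s y\<rbrakk>\<^bsub>L\<^esub> \<ominus>\<^bsub>L\<^esub> s \<lbrakk>x, y\<rbrakk>\<^bsub>G\<^esub>)" for x y
  define \<psi> where "\<psi> x h = j \<lbrakk>s x, i h\<rbrakk>\<^bsub>L\<^esub>" for x h
  define \<Phi> where "\<Phi> x = j (U (s x) \<ominus>\<^bsub>L\<^esub> s (P x))" for x
  have ker_\<chi>: "p (\<lbrakk>s x, s y\<rbrakk>\<^bsub>L\<^esub> \<ominus>\<^bsub>L\<^esub> s \<lbrakk>x, y\<rbrakk>\<^bsub>G\<^esub>) = \<zero>\<^bsub>G\<^esub>" if "x \<in> carrier G" "y \<in> carrier G" for x y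
    using that by (simp add: p_bracket p_s G.M.minus_eq_zero_iff)
  have ker_\<psi>: "p \<lbrakk>s x, i h\<rbrakk>\<^bsub>L\<^esub> = \<zero>\<^bsub>G\<^esub>" if "x \<in> carrier G" "h \<in> carrier H" for x h
    using that by (simp add: p_bracket p_s p_i)
  have ker_\<Phi>: "p (U (s x) \<ominus>\<^bsub>L\<^esub> s (P x)) = \<zero>\<^bsub>G\<^esub>" if "x \<in> carrier G" for x
    using that by (simp add: p_U p_s G.M.minus_eq_zero_iff)
  have "sectioned_space K G P H Q L U i p s \<chi> \<psi> \<Phi>"
  proof unfold_locales
    show "\<lbrakk>s x, s y\<rbrakk>\<^bsub>L\<^esub> = s \<lbrakk>x, y\<rbrakk>\<^bsub>G\<^esub> \<oplus>\<^bsub>L\<^esub> i (\<chi> x y)" if "x \<in> carrier G" "y \<in> carrier G" for x y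
      unfolding \<chi>_def using that ker_\<chi>[OF that] by (subst j) (simp_all add: add_minus)
    show "U (s x) = s (P x) \<oplus>\<^bsub>L\<^esub> i (\<Phi> x)" if "x \<in> carrier G" for x
      unfolding \<Phi>_def using that ker_\<Phi>[OF that] by (subst j) (simp_all add: add_minus)
    show "\<lbrakk>s x, i h\<rbrakk>\<^bsub>L\<^esub> = i (\<psi> x h)" if "x \<in> carrier G" "h \<in> carrier H" for x h
      unfolding \<psi>_def using that by (subst j) (simp_all add: ker_\<psi>)
    show "\<lbrakk>i h, i k\<rbrakk>\<^bsub>L\<^esub> = i \<lbrakk>h, k\<rbrakk>\<^bsub>H\<^esub>" "U (i h) = i (Q h)" if "h \<in> carrier H" "k \<in> carrier H" for h k
      using i_hom that by (auto simp: averaging_hom_def)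
    show "\<chi> x y \<in> carrier H" if "x \<in> carrier G" "y \<in> carrier G" for x y
      unfolding \<chi>_def using that ker_\<chi>[OF that] by (intro j) simp_all
    show "\<psi> x h \<in> carrier H" if "x \<in> carrier G" "h \<in> carrier H" for x h
      unfolding \<psi>_def using that ker_\<psi>[OF that] by (intro j) simp_all
    show "\<Phi> x \<in> carrier H" if "x \<in> carrier G" for x
      unfolding \<Phi>_def using that ker_\<Phi>[OF that] by (intro j) simp_all
  qed (use inj kernel p_s in auto)
  then show ?thesis
    by (intro exI[of _ "(\<chi>, \<psi>, \<Phi>)"])
      (auto simp: cocycle_of_extension_def L_def U_def i_def p_def)
qed

end

text \<open>
  The direct sum of \<open>G\<close> and \<open>H\<close> with bracket
  \<open>[(x, h), (y, k)] = ([x, y], \<chi> x y + \<psi> x k - \<psi> y h + [h, k])\<close> and operator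
  \<open>(x, h) \<mapsto> (P x, \<Phi> x + Q h)\<close>, carried over along \<open>\<iota>\<close> to a subset of the type \<open>'e\<close>. The bound
  \<open>x\<close> and \<open>h\<close> read off the coordinates of an element.
\<close>
definition crossed_product ::
  "('k, 'g) lie \<Rightarrow> ('g \<Rightarrow> 'g) \<Rightarrow> ('k, 'h) lie \<Rightarrow> ('h \<Rightarrow> 'h) \<Rightarrow> ('g \<times> 'h \<Rightarrow> 'e) \<Rightarrow>
   ('g, 'h) cochain \<Rightarrow> ('k, 'g, 'h, 'e) lie_extension"
where
  "crossed_product G P H Q \<iota> = (\<lambda>(\<chi>, \<psi>, \<Phi>).
     let x = (\<lambda>a. fst (inv_into (carrier G \<times> carrier H) \<iota> a));
         h = (\<lambda>a. snd (inv_into (carrier G \<times> carrier H) \<iota> a))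
     in \<lparr>ext_alg = \<lparr>carrier = \<iota> ` (carrier G \<times> carrier H), monoid.mult = undefined, monoid.one = undefined,
            ring.zero = \<iota> (\<zero>\<^bsub>G\<^esub>, \<zero>\<^bsub>H\<^esub>),
            ring.add = (\<lambda>a b. \<iota> (x a \<oplus>\<^bsub>G\<^esub> x b, h a \<oplus>\<^bsub>H\<^esub> h b)),
            module.smult = (\<lambda>k a. \<iota> (k \<odot>\<^bsub>G\<^esub> x a, k \<odot>\<^bsub>H\<^esub> h a)),
            lie_bracket = (\<lambda>a b. \<iota> (\<lbrakk>x a, x b\<rbrakk>\<^bsub>G\<^esub>,
              \<chi> (x a) (x b) \<oplus>\<^bsub>H\<^esub> \<psi> (x a) (h b) \<ominus>\<^bsub>H\<^esub> \<psi> (x b) (h a) \<oplus>\<^bsub>H\<^esub> \<lbrakk>h a, h b\<rbrakk>\<^bsub>H\<^esub>))\<rparr>,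
          ext_op = (\<lambda>a. \<iota> (P (x a), \<Phi> (x a) \<oplus>\<^bsub>H\<^esub> Q (h a))),
          ext_incl = (\<lambda>k. \<iota> (\<zero>\<^bsub>G\<^esub>, k)),
          ext_proj = x\<rparr>)"

text \<open>
  The section \<open>x \<mapsto> (x, 0)\<close> induces the triple. That the crossed product is an extension when the
  triple is a cocycle then follows from the general equivalence of the two properties.
\<close>
lemma (in averaging_pair) cocycle_of_crossed_product:
  fixes \<iota> :: "'g \<times> 'h \<Rightarrow> 'e"
  assumes inj: "inj_on \<iota> (carrier G \<times> carrier H)"
    and \<chi>: "alternating_bilinear_map K G H \<chi>" and \<psi>: "linear_map_to_Der K G H \<psi>"
    and \<Phi>: "linear_map K G H \<Phi>"
  shows "cocycle_of_extension K G P H Q (crossed_product G P H Q \<iota> (\<chi>, \<psi>, \<Phi>)) (\<chi>, \<psi>, \<Phi>)"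
proof -
  define E where "E = crossed_product G P H Q \<iota> (\<chi>, \<psi>, \<Phi>)"
  let ?L = "ext_alg E"
  interpret \<chi>: alternating_map K G H \<chi> using \<chi> by unfold_locales
  interpret \<Phi>: linear_hom K G H \<Phi> using \<Phi> by unfold_locales
  have \<psi>_left: "linear_hom K G H (\<lambda>x. \<psi> x h)" if "h \<in> carrier H" for h
    using \<psi> that by unfold_locales (simp add: linear_map_to_Der_def)
  have \<psi>_right: "linear_hom K H H (\<psi> x)" if "x \<in> carrier G" for x
    using \<psi> that by unfold_locales (simp add: linear_map_to_Der_def derivation_def)
  note \<psi>_simps [simp] = linear_hom.closed[OF \<psi>_right] linear_hom.zero[OF \<psi>_right] linear_hom.zero[OF \<psi>_left]
    linear_hom.add[OF \<psi>_right] linear_hom.add[OF \<psi>_left] linear_hom.smult[OF \<psi>_right] linear_hom.smult[OF \<psi>_left]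
  note coords [simp] = inv_into_f_f[OF inj, OF SigmaI]
  have \<iota>_eq [simp]: "\<iota> (x, h) = \<iota> (y, k) \<longleftrightarrow> x = y \<and> h = k"
    if "x \<in> carrier G" "h \<in> carrier H" "y \<in> carrier G" "k \<in> carrier H" for x h y k
    using inj that by (auto dest: inj_onD)
  have carrier [simp]: "carrier ?L = \<iota> ` (carrier G \<times> carrier H)"
    and zero [simp]: "\<zero>\<^bsub>?L\<^esub> = \<iota> (\<zero>\<^bsub>G\<^esub>, \<zero>\<^bsub>H\<^esub>)"
    and incl [simp]: "ext_incl E k = \<iota> (\<zero>\<^bsub>G\<^esub>, k)" for k
    by (simp_all add: E_def crossed_product_def Let_def)
  have add [simp]: "\<iota> (x, h) \<oplus>\<^bsub>?L\<^esub> \<iota> (y, k) = \<iota> (x \<oplus>\<^bsub>G\<^esub> y, h \<oplus>\<^bsub>H\<^esub> k)"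
    and bracket [simp]: "\<lbrakk>\<iota> (x, h), \<iota> (y, k)\<rbrakk>\<^bsub>?L\<^esub> =
      \<iota> (\<lbrakk>x, y\<rbrakk>\<^bsub>G\<^esub>, \<chi> x y \<oplus>\<^bsub>H\<^esub> \<psi> x k \<ominus>\<^bsub>H\<^esub> \<psi> y h \<oplus>\<^bsub>H\<^esub> \<lbrakk>h, k\<rbrakk>\<^bsub>H\<^esub>)"
    if "x \<in> carrier G" "h \<in> carrier H" "y \<in> carrier G" "k \<in> carrier H" for x h y k
    using that by (simp_all add: E_def crossed_product_def Let_def)
  have smult [simp]: "c \<odot>\<^bsub>?L\<^esub> \<iota> (x, h) = \<iota> (c \<odot>\<^bsub>G\<^esub> x, c \<odot>\<^bsub>H\<^esub> h)"
    and op [simp]: "ext_op E (\<iota> (x, h)) = \<iota> (P x, \<Phi> x \<oplus>\<^bsub>H\<^esub> Q h)"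
    and proj [simp]: "ext_proj E (\<iota> (x, h)) = x"
    if "x \<in> carrier G" "h \<in> carrier H" for x h c
    using that by (simp_all add: E_def crossed_product_def Let_def)
  note distrib = G.smult_l_distr H.smult_l_distr G.smult_r_distr H.smult_r_distr G.smult_assoc1 H.smult_assoc1
    H.smult_r_minus
  have module: "module K ?L"
  proof (rule moduleI)
    show "abelian_group ?L"
    proof (rule abelian_groupI)
      fix a assume "a \<in> carrier ?L"
      then obtain x h where a: "a = \<iota> (x, h)" "x \<in> carrier G" "h \<in> carrier H" by auto
      then have "\<iota> (\<ominus>\<^bsub>G\<^esub> x, \<ominus>\<^bsub>H\<^esub> h) \<in> carrier ?L" "\<iota> (\<ominus>\<^bsub>G\<^esub> x, \<ominus>\<^bsub>H\<^esub> h) \<oplus>\<^bsub>?L\<^esub> a = \<zero>\<^bsub>?L\<^esub>"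
        by (auto simp: G.M.l_neg H.M.l_neg)
      then show "\<exists>b\<in>carrier ?L. b \<oplus>\<^bsub>?L\<^esub> a = \<zero>\<^bsub>?L\<^esub>" by blast
    qed (auto simp: G.M.a_ac H.M.a_ac)
  qed (auto simp: G.is_cring distrib)
  interpret L: alternating_map K ?L ?L "lie_bracket ?L"
    by (rule alternating_mapI[OF module module])
      (auto simp: distrib a_minus_def H.M.minus_add H.M.a_ac H.M.r_neg)
  have "sectioned_space K G P H Q ?L (ext_op E) (ext_incl E) (ext_proj E) (\<lambda>x. \<iota> (x, \<zero>\<^bsub>H\<^esub>)) \<chi> \<psi> \<Phi>"
  proof unfold_locales
    show "linear_map K ?L ?L (ext_op E)" "linear_map K H ?L (ext_incl E)"
      "linear_map K ?L G (ext_proj E)" "linear_map K G ?L (\<lambda>x. \<iota> (x, \<zero>\<^bsub>H\<^esub>))"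
      by (rule linear_mapI; auto simp: distrib H.M.a_ac)+
    show "inj_on (ext_incl E) (carrier H)" by (rule inj_onI) simp
    show "ext_incl E ` carrier H = {a \<in> carrier ?L. ext_proj E a = \<zero>\<^bsub>G\<^esub>}" by auto
  qed (simp_all add: a_minus_def)
  then show ?thesis unfolding E_def cocycle_of_extension_def by auto
qed

text \<open>
  The five lemma: a morphism that is the identity on \<open>H\<close> and on \<open>G\<close> is bijective, and its inverse is
  again a morphism.
\<close>
lemma (in averaging_pair) extension_equivalent_sym:
  assumes E: "nonabelian_extension K G P H Q E" and E': "nonabelian_extension K G P H Q E'"
    and eq: "extension_equivalent K G H E E'"
  shows "extension_equivalent K G H E' E"
proof -
  let ?L = "ext_alg E" and ?L' = "ext_alg E'"
  obtain \<tau> where hom: "averaging_hom K ?L (ext_op E) ?L' (ext_op E') \<tau>"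
    and \<tau>_i: "\<And>h. h \<in> carrier H \<Longrightarrow> \<tau> (ext_incl E h) = ext_incl E' h"
    and \<tau>_p: "\<And>a. a \<in> carrier ?L \<Longrightarrow> ext_proj E' (\<tau> a) = ext_proj E a"
    using eq unfolding extension_equivalent_def by blast
  interpret L: averaging_lie_algebra K ?L "ext_op E" using E by (simp add: nonabelian_extension_def)
  interpret L': averaging_lie_algebra K ?L' "ext_op E'" using E' by (simp add: nonabelian_extension_def)
  interpret \<tau>: linear_hom K ?L ?L' \<tau> using hom by unfold_locales (simp add: averaging_hom_def)
  have \<tau>_bracket: "\<tau> \<lbrakk>a, b\<rbrakk>\<^bsub>?L\<^esub> = \<lbrakk>\<tau> a, \<tau> b\<rbrakk>\<^bsub>?L'\<^esub>" if "a \<in> carrier ?L" "b \<in> carrier ?L" for a b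
    using hom that by (simp add: averaging_hom_def)
  have \<tau>_op: "ext_op E' (\<tau> a) = \<tau> (ext_op E a)" if "a \<in> carrier ?L" for a
    using hom that by (simp add: averaging_hom_def)
  note ext = E[unfolded nonabelian_extension_def] and ext' = E'[unfolded nonabelian_extension_def]
  interpret i: linear_hom K H ?L "ext_incl E"
    using ext unfolding averaging_hom_def by unfold_locales blast
  interpret i': linear_hom K H ?L' "ext_incl E'"
    using ext' unfolding averaging_hom_def by unfold_locales blast
  interpret p: linear_hom K ?L G "ext_proj E"
    using ext unfolding averaging_hom_def by unfold_locales blast
  interpret p': linear_hom K ?L' G "ext_proj E'"
    using ext' unfolding averaging_hom_def by unfold_locales blast
  have kernel: "ext_incl E ` carrier H = {a \<in> carrier ?L. ext_proj E a = \<zero>\<^bsub>G\<^esub>}"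
    and kernel': "ext_incl E' ` carrier H = {a \<in> carrier ?L'. ext_proj E' a = \<zero>\<^bsub>G\<^esub>}"
    and inj': "inj_on (ext_incl E') (carrier H)"
    and surj: "ext_proj E ` carrier ?L = carrier G"
    using ext ext' by blast+
  have inj: "inj_on \<tau> (carrier ?L)"
  proof (rule \<tau>.inj_onI_kernel)
    fix a assume a: "a \<in> carrier ?L" "\<tau> a = \<zero>\<^bsub>?L'\<^esub>"
    then have "ext_proj E a = \<zero>\<^bsub>G\<^esub>" using \<tau>_p[of a] by simp
    then obtain h where h: "h \<in> carrier H" "a = ext_incl E h" using a kernel by blast
    then have "ext_incl E' h = ext_incl E' \<zero>\<^bsub>H\<^esub>" using a by (simp add: \<tau>_i)
    then have "h = \<zero>\<^bsub>H\<^esub>" using inj' h by (simp add: inj_on_eq_iff del: i'.zero)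
    then show "a = \<zero>\<^bsub>?L\<^esub>" using h by simp
  qed
  have onto: "\<tau> ` carrier ?L = carrier ?L'"
  proof
    show "carrier ?L' \<subseteq> \<tau> ` carrier ?L"
    proof
      fix b assume b: "b \<in> carrier ?L'"
      then have "ext_proj E' b \<in> ext_proj E ` carrier ?L" by (simp add: surj)
      then obtain a where a: "a \<in> carrier ?L" "ext_proj E' b = ext_proj E a" by blast
      then have "b \<ominus>\<^bsub>?L'\<^esub> \<tau> a \<in> ext_incl E' ` carrier H"
        using b by (subst kernel') (simp add: \<tau>_p G.M.minus_eq_zero_iff)
      then obtain h where h: "h \<in> carrier H" "b \<ominus>\<^bsub>?L'\<^esub> \<tau> a = ext_incl E' h" by blast
      then have "b = \<tau> (ext_incl E h \<oplus>\<^bsub>?L\<^esub> a)"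
        using a b by (simp add: \<tau>_i L'.minus_eq_iff)
      then show "b \<in> \<tau> ` carrier ?L" using a h by (auto simp del: \<tau>.add)
    qed
  qed auto
  define \<sigma> where "\<sigma> = inv_into (carrier ?L) \<tau>"
  have \<sigma>_\<tau> [simp]: "\<sigma> (\<tau> a) = a" if "a \<in> carrier ?L" for a
    unfolding \<sigma>_def using inj that by (rule inv_into_f_f)
  have \<tau>_cases: "\<exists>a\<in>carrier ?L. b = \<tau> a" if "b \<in> carrier ?L'" for b
    using onto that by blast
  have "averaging_hom K ?L' (ext_op E') ?L (ext_op E) \<sigma>"
    unfolding averaging_hom_def
  proof (intro conjI ballI)
    show "linear_map K ?L' ?L \<sigma>" unfolding \<sigma>_def by (rule \<tau>.linear_inv[OF inj onto])
    fix b assume "b \<in> carrier ?L'"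
    then obtain a where a: "a \<in> carrier ?L" "b = \<tau> a" using \<tau>_cases by blast
    then show "ext_op E (\<sigma> b) = \<sigma> (ext_op E' b)" by (simp add: \<tau>_op)
    fix b' assume "b' \<in> carrier ?L'"
    then obtain a' where a': "a' \<in> carrier ?L" "b' = \<tau> a'" using \<tau>_cases by blast
    then show "\<sigma> \<lbrakk>b, b'\<rbrakk>\<^bsub>?L'\<^esub> = \<lbrakk>\<sigma> b, \<sigma> b'\<rbrakk>\<^bsub>?L\<^esub>" using a by (simp flip: \<tau>_bracket)
  qed
  moreover have "\<sigma> (ext_incl E' h) = ext_incl E h" if "h \<in> carrier H" for h
    using that by (simp flip: \<tau>_i)
  moreover have "ext_proj E (\<sigma> b) = ext_proj E' b" if "b \<in> carrier ?L'" for b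
    using \<tau>_cases[OF that] by (auto simp: \<tau>_p)
  ultimately show ?thesis unfolding extension_equivalent_def by blast
qed

lemma (in averaging_pair) equiv_extension_equivalent:
  "equiv {E. nonabelian_extension K G P H Q E}
     {(E, E'). nonabelian_extension K G P H Q E \<and> nonabelian_extension K G P H Q E' \<and>
               extension_equivalent K G H E E'}"
proof (rule equivI)
  show "refl_on {E. nonabelian_extension K G P H Q E}
     {(E, E'). nonabelian_extension K G P H Q E \<and> nonabelian_extension K G P H Q E' \<and>
               extension_equivalent K G H E E'}"
    by (rule refl_onI)
      (auto simp: extension_equivalent_def averaging_hom_def linear_map_def intro!: exI[of _ "\<lambda>a. a"])
  show "sym {(E, E'). nonabelian_extension K G P H Q E \<and> nonabelian_extension K G P H Q E' \<and>
               extension_equivalent K G H E E'}"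
    by (rule symI) (auto intro: extension_equivalent_sym)
  have "extension_equivalent K G H E E''"
    if eq: "extension_equivalent K G H E E'" and eq': "extension_equivalent K G H E' E''"
    for E E' E'' :: "('k, 'g, 'h, 'e) lie_extension"
  proof -
    obtain \<tau> where \<tau>: "averaging_hom K (ext_alg E) (ext_op E) (ext_alg E') (ext_op E') \<tau>"
      "\<forall>h\<in>carrier H. \<tau> (ext_incl E h) = ext_incl E' h"
      "\<forall>a\<in>carrier (ext_alg E). ext_proj E' (\<tau> a) = ext_proj E a"
      using eq unfolding extension_equivalent_def by blast
    obtain \<tau>' where \<tau>': "averaging_hom K (ext_alg E') (ext_op E') (ext_alg E'') (ext_op E'') \<tau>'"
      "\<forall>h\<in>carrier H. \<tau>' (ext_incl E' h) = ext_incl E'' h"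
      "\<forall>a\<in>carrier (ext_alg E'). ext_proj E'' (\<tau>' a) = ext_proj E' a"
      using eq' unfolding extension_equivalent_def by blast
    have "averaging_hom K (ext_alg E) (ext_op E) (ext_alg E'') (ext_op E'') (\<lambda>a. \<tau>' (\<tau> a))"
      using \<tau>(1) \<tau>'(1) by (simp add: averaging_hom_def linear_map_def Pi_iff)
    moreover have "\<tau> a \<in> carrier (ext_alg E')" if "a \<in> carrier (ext_alg E)" for a
      using \<tau>(1) that by (simp add: averaging_hom_def linear_map_def Pi_iff)
    ultimately show ?thesis
      unfolding extension_equivalent_def using \<tau>(2,3) \<tau>'(2,3) by (intro exI[of _ "\<lambda>a. \<tau>' (\<tau> a)"]) simp
  qed
  then show "trans {(E, E'). nonabelian_extension K G P H Q E \<and> nonabelian_extension K G P H Q E' \<and>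
               extension_equivalent K G H E E'}"
    by (intro transI) blast
qed auto

section \<open>The classification\<close>

theorem theorem4p5:
  fixes K :: "('k, 'r) ring_scheme"
    and G :: "('k, 'g) lie" and P :: "'g \<Rightarrow> 'g"
    and H :: "('k, 'h) lie" and Q :: "'h \<Rightarrow> 'h"
    and \<iota> :: "'g \<times> 'h \<Rightarrow> 'e"
  assumes "char_zero_field K"
    and "averaging_lie_algebra K G P"
    and "averaging_lie_algebra K H Q"
    and "inj_on \<iota> (carrier G \<times> carrier H)"
  shows "\<exists>F. bij_betw F
           (Ext_nab K G P H Q :: ('k, 'g, 'h, 'e) lie_extension set set)
           (H2_nab K G P H Q)"
proof -
  interpret averaging_pair K G P H Q
    using assms(2,3) by (rule averaging_pair.intro)
  show ?thesis
    unfolding Ext_nab_def H2_nab_def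
  proof (rule bij_betw_quotients_of_correspondence[where D = "cocycle_of_extension K G P H Q",
        OF equiv_extension_equivalent])
    fix E :: "('k, 'g, 'h, 'e) lie_extension"
    assume "E \<in> {E. nonabelian_extension K G P H Q E}"
    then show "\<exists>c\<in>{c. nonabelian_cocycle K G P H Q c}. cocycle_of_extension K G P H Q E c"
      using extension_has_cocycle extension_iff_cocycle by blast
  next
    fix c assume "c \<in> {c. nonabelian_cocycle K G P H Q c}"
    then have c: "nonabelian_cocycle K G P H Q c" by simp
    then have "cocycle_of_extension K G P H Q (crossed_product G P H Q \<iota> c) c"
      using cocycle_of_crossed_product[OF assms(4)] by (cases c) (simp add: nonabelian_cocycle_def)
    then show "\<exists>E\<in>{E :: ('k, 'g, 'h, 'e) lie_extension. nonabelian_extension K G P H Q E}. cocycle_of_extension K G P H Q E c"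
      using c extension_iff_cocycle by blast
  next
    fix E E' :: "('k, 'g, 'h, 'e) lie_extension" and c c'
    assume "cocycle_of_extension K G P H Q E c" "cocycle_of_extension K G P H Q E' c'"
      and "E \<in> {E. nonabelian_extension K G P H Q E}" "E' \<in> {E. nonabelian_extension K G P H Q E}"
      and "c \<in> {c. nonabelian_cocycle K G P H Q c}" "c' \<in> {c. nonabelian_cocycle K G P H Q c}"
    then show "(E, E') \<in> {(E, E'). nonabelian_extension K G P H Q E \<and> nonabelian_extension K G P H Q E' \<and>
          extension_equivalent K G H E E'} \<longleftrightarrow>
        (c, c') \<in> {(c, c'). nonabelian_cocycle K G P H Q c \<and> nonabelian_cocycle K G P H Q c' \<and>
          cocycle_equivalent K G P H Q c c'}"
      using extension_equivalent_iff_cocycle_equivalent by simp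
  qed auto
qed

end
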